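(* Let $J$ be a bounded half-line Jacobi matrix, let $N_j\to\infty$ be a sequence along which the limits described in the context exist, and let $\gamma:\mathbb{R}\to\mathbb{R}$ be the associated Lyapunov exponent. For $x\in\mathbb{R}$, $\epsilon>0$ let $A(x,\epsilon;\gamma)=\{y\in\mathbb{R}:|\gamma(y)-\gamma(x)|\ge\epsilon\}$. Then for every $x\in\mathbb{R}$, $$\operatorname{cap}\left[ A(x,\epsilon;\gamma)\cap (x-h,x+h)\right] = o(h^N)\qquad (h\to 0+)$$ for arbitrary $N\ge 1$, $\epsilon>0$.
   Context: $\operatorname{cap}(S)$ denotes the logarithmic capacity of $S$: $\operatorname{cap}(S)=\sup_\mu e^{I(\mu)}$, $I(\mu)=\iint\ln|s-t|\,d\mu(s)\,d\mu(t)$, the supremum being over Borel probability measures $\mu$ with compact support contained in $S$ (with $e^{-\infty}=0$). Setting: a Herglotz function is a holomorphic map of $\mathbb{C}^+=\{z\in\mathbb{C}:\operatorname{Im}z>0\}$ to itself. Let $J$ be a half-line Jacobi matrix on $\ell_2(\mathbb{Z}_+)$, $\mathbb{Z}_+=\{1,2,\dots\}$: $(Ju)(n)=a(n)u(n+1)+a(n-1)u(n-1)+b(n)u(n)$ (term with $u(n-1)$ omitted for $n=1$), with real coefficients satisfying $(M+1)^{-1}\le a(n)\le M+1$, $|b(n)|\le M$ for some $M>0$. Put $a(0)=1$. For $z\in\mathbb{C}^+$ let $f_\pm(n,z)$ be the solutions of $a(n)f(n+1)+a(n-1)f(n-1)+b(n)f(n)=zf(n)$ ($n\ge1$) with $f_-(0,z)=0$,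 $f_-(1,z)=1$, $f_+(0,z)=1$, $f_+(1,z)=-\langle\delta_1,(J-z)^{-1}\delta_1\rangle$. Then $f_\pm(n,z)\ne0$ for $n\ge1$ and $z\mapsto\mp f_\pm(n+1,z)/f_\pm(n,z)$ are Herglotz functions. With the logarithm satisfying $\operatorname{Im}\ln\zeta\in(0,\pi)$ for $\zeta\in\mathbb{C}^+$, put $$w_\pm^{(N)}(z)=\frac1N\sum_{n=1}^N\ln\left[\mp\frac{f_\pm(n+1,z)}{f_\pm(n,z)}\right],\qquad g_N(z)=\frac1N\sum_{n=1}^N\langle\delta_n,(J-z)^{-1}\delta_n\rangle=\int_{\mathbb{R}}\frac{d\nu_N(t)}{t-z},$$ $d\nu_N(t)=\frac1N\sum_{n=1}^N d\|E(t)\delta_n\|^2$ ($E$ the spectral resolution of $J$), and $dk_N=\frac1N\sum_{n=1}^N\delta_{\lambda_n^{(N)}}$, where $\lambda_1^{(N)},\dots,\lambda_N^{(N)}$ are the eigenvalues of the truncation of $J$ to $\ell_2(\{1,\dots,N\})$ (boundary conditions $u(0)=u(N+1)=0$). $N_j\to\infty$ is a fixed (otherwise arbitrary) sequence such that, as $j\to\infty$, $w_\pm^{(N_j)}\to w_\pm$ and $g_{N_j}\to g$ uniformly on compact subsets of $\mathbb{C}^+$ with Herglotz limits, $\nu_{N_j}$ and $dk_{N_j}$ converge in weak $*$ sense to probability measures, and $(a(1)\cdots a(N_j))^{1/N_j}\to A>0$. Write $w_+=-\gamma+i\pi k$ with $\gamma,k$ real valued on $\mathbb{C}^+$, and put $\gamma(t)=\lim_{y\to0+}\gamma(t+iy)$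 for $t\in\mathbb{R}$ (this limit exists, and is finite, for every $t$). $\gamma$ is called the Lyapunov exponent. *)

theory Defs
  imports
    "HOL-Complex_Analysis.Complex_Analysis"
    "HOL-Probability.Probability"
    "Jordan_Normal_Form.Char_Poly"
begin

definition measure_support :: "real measure \<Rightarrow> real set" where
  "measure_support \<mu> = {x. \<forall>U. open U \<longrightarrow> x \<in> U \<longrightarrow> emeasure \<mu> U > 0}"

text \<open>Logarithm of a nonnegative real with \<open>ln 0 = -\<infinity>\<close> (the library has \<open>ln 0 = 0\<close>),
  and exponential with \<open>exp (-\<infinity>) = 0\<close>.\<close>

definition ln_ext :: "real \<Rightarrow> ereal" where
  "ln_ext r = (if r = 0 then -\<infinity> else ereal (ln r))"

definition exp_ext :: "ereal \<Rightarrow> ennreal" where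
  "exp_ext x = (case x of ereal r \<Rightarrow> ennreal (exp r) | PInfty \<Rightarrow> \<infinity> | MInfty \<Rightarrow> 0)"

text \<open>The double integral of \<open>ln \<bar>s - t\<bar>\<close> is the integral of the positive part minus that of the
  negative part (\<open>e2ennreal\<close> sends negative arguments to 0). For compactly supported \<open>\<mu>\<close> the
  first of these is finite, so the difference never has the form \<open>\<infinity> - \<infinity>\<close>.\<close>

definition log_energy :: "real measure \<Rightarrow> ereal" where
  "log_energy \<mu> =
     enn2ereal (\<integral>\<^sup>+s. \<integral>\<^sup>+t. e2ennreal (ln_ext \<bar>s - t\<bar>) \<partial>\<mu> \<partial>\<mu>)
   - enn2ereal (\<integral>\<^sup>+s. \<integral>\<^sup>+t. e2ennreal (- ln_ext \<bar>s - t\<bar>) \<partial>\<mu> \<partial>\<mu>)"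

definition log_cap :: "real set \<Rightarrow> ennreal" where
  "log_cap S =
     (SUP \<mu> \<in> {\<mu>. real_distribution \<mu> \<and> compact (measure_support \<mu>) \<and> measure_support \<mu> \<subseteq> S}.
        exp_ext (log_energy \<mu>))"

text \<open>Bounded sets have finite capacity, so \<^term>\<open>enn2real\<close> loses nothing on them.\<close>

lemma AE_in_measure_support:
  assumes "real_distribution \<mu>"
  shows "AE x in \<mu>. x \<in> measure_support \<mu>"
proof -
  interpret real_distribution \<mu> by fact
  define F where "F = {U::real set. open U \<and> emeasure \<mu> U = 0}"
  obtain F' where F': "F' \<subseteq> F" "countable F'" "\<Union>F' = \<Union>F"
    using Lindelof[of F] unfolding F_def by blast
  have "(\<Union>F') \<in> null_sets \<mu>"
    using null_sets_UN'[OF F'(2), of "\<lambda>x. x" \<mu>, unfolded image_ident] F'(1)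
    by (metis (mono_tags, lifting) F_def borel_open events_eq_borel mem_Collect_eq null_setsI subsetD)
  moreover have "{x \<in> space \<mu>. x \<notin> measure_support \<mu>} \<subseteq> \<Union>F'"
    unfolding F'(3) by (auto simp: measure_support_def F_def not_less)
  ultimately show ?thesis by (rule AE_I')
qed

lemma log_cap_finite:
  assumes "bounded S"
  shows "log_cap S < \<infinity>"
proof -
  obtain D where D: "D \<ge> 1" "\<And>s t. s \<in> S \<Longrightarrow> t \<in> S \<Longrightarrow> \<bar>s - t\<bar> \<le> D"
  proof -
    obtain B where B: "\<And>s. s \<in> S \<Longrightarrow> \<bar>s\<bar> \<le> B" using assms by (auto simp: bounded_iff)
    have "\<bar>s - t\<bar> \<le> max 1 (2 * B)" if "s \<in> S" "t \<in> S" for s t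
      using B[OF that(1)] B[OF that(2)] by linarith
    then show ?thesis using that[of "max 1 (2 * B)"] by auto
  qed
  have "exp_ext (log_energy \<mu>) \<le> ennreal D"
    if \<mu>: "real_distribution \<mu>" and sub: "measure_support \<mu> \<subseteq> S" for \<mu>
  proof -
    interpret real_distribution \<mu> by fact
    have ae: "AE x in \<mu>. x \<in> S"
      using AE_in_measure_support[OF \<mu>] sub by (auto elim: AE_mp)
    have le: "e2ennreal (ln_ext \<bar>s - t\<bar>) \<le> ennreal (ln D)" if "s \<in> S" "t \<in> S" for s t
    proof -
      have "ln_ext \<bar>s - t\<bar> \<le> ereal (ln D)"
        using D(2)[OF that] by (auto simp: ln_ext_def)
      then show ?thesis
        using e2ennreal_mono by fastforce
    qed
    have "(\<integral>\<^sup>+t. e2ennreal (ln_ext \<bar>s - t\<bar>) \<partial>\<mu>) \<le> ennreal (ln D)" if "s \<in> S" for s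
    proof -
      have "(\<integral>\<^sup>+t. e2ennreal (ln_ext \<bar>s - t\<bar>) \<partial>\<mu>) \<le> (\<integral>\<^sup>+t. ennreal (ln D) \<partial>\<mu>)"
        using ae by (intro nn_integral_mono_AE) (auto intro: le that)
      then show ?thesis using emeasure_space_1 by simp
    qed
    then have "(\<integral>\<^sup>+s. \<integral>\<^sup>+t. e2ennreal (ln_ext \<bar>s - t\<bar>) \<partial>\<mu> \<partial>\<mu>) \<le> (\<integral>\<^sup>+s. ennreal (ln D) \<partial>\<mu>)"
      using ae by (intro nn_integral_mono_AE) auto
    then have "(\<integral>\<^sup>+s. \<integral>\<^sup>+t. e2ennreal (ln_ext \<bar>s - t\<bar>) \<partial>\<mu> \<partial>\<mu>) \<le> ennreal (ln D)"
      using emeasure_space_1 by simp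
    then have pos: "enn2ereal (\<integral>\<^sup>+s. \<integral>\<^sup>+t. e2ennreal (ln_ext \<bar>s - t\<bar>) \<partial>\<mu> \<partial>\<mu>) \<le> ereal (ln D)"
      using D(1) by (metis enn2ereal_ennreal less_eq_ennreal.rep_eq ln_ge_zero)
    have "log_energy \<mu> \<le> ereal (ln D)"
      unfolding log_energy_def
      using ereal_minus_mono[OF pos, of 0] enn2ereal_nonneg by (simp add: zero_ereal_def)
    then show ?thesis
      using D(1) by (cases "log_energy \<mu>") (auto simp: exp_ext_def ln_ge_iff)
  qed
  then have "log_cap S \<le> ennreal D"
    unfolding log_cap_def by (intro SUP_least) auto
  also have "\<dots> < \<infinity>" by simp
  finally show ?thesis .
qed

text \<open>Square-summable sequences over the positive integers are functions on \<^typ>\<open>nat\<close> that vanish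
  at 0. The inner product is linear in the second argument.\<close>

definition ell2 :: "(nat \<Rightarrow> complex) set" where
  "ell2 = {u. u 0 = 0 \<and> summable (\<lambda>n. (cmod (u n))\<^sup>2)}"

definition ell2_inner :: "(nat \<Rightarrow> complex) \<Rightarrow> (nat \<Rightarrow> complex) \<Rightarrow> complex" where
  "ell2_inner u v = (\<Sum>n. cnj (u n) * v n)"

definition ell2_norm :: "(nat \<Rightarrow> complex) \<Rightarrow> real" where
  "ell2_norm u = sqrt (\<Sum>n. (cmod (u n))\<^sup>2)"

definition delta :: "nat \<Rightarrow> nat \<Rightarrow> complex" where
  "delta n = (\<lambda>m. if m = n then 1 else 0)"

definition jacobi_op ::
  "(nat \<Rightarrow> real) \<Rightarrow> (nat \<Rightarrow> real) \<Rightarrow> (nat \<Rightarrow> complex) \<Rightarrow> nat \<Rightarrow> complex" where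
  "jacobi_op a b u n =
     (if n = 0 then 0
      else a n * u (n + 1) + (if n = 1 then 0 else a (n - 1) * u (n - 1)) + b n * u n)"

definition resolvent ::
  "(nat \<Rightarrow> real) \<Rightarrow> (nat \<Rightarrow> real) \<Rightarrow> complex \<Rightarrow> (nat \<Rightarrow> complex) \<Rightarrow> nat \<Rightarrow> complex" where
  "resolvent a b z = inv_into ell2 (\<lambda>u n. jacobi_op a b u n - z * u n)"

definition green :: "(nat \<Rightarrow> real) \<Rightarrow> (nat \<Rightarrow> real) \<Rightarrow> nat \<Rightarrow> complex \<Rightarrow> complex" where
  "green a b n z = ell2_inner (delta n) (resolvent a b z (delta n))"

text \<open>The solution of \<open>a(n) f(n+1) + a(n-1) f(n-1) + b(n) f(n) = z f(n)\<close>, \<open>n \<ge> 1\<close>, with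
  \<open>f(0) = c0\<close>, \<open>f(1) = c1\<close>.\<close>

fun jacobi_sol ::
  "(nat \<Rightarrow> real) \<Rightarrow> (nat \<Rightarrow> real) \<Rightarrow> complex \<Rightarrow> complex \<Rightarrow> complex \<Rightarrow> nat \<Rightarrow> complex" where
  "jacobi_sol a b z c0 c1 0 = c0"
| "jacobi_sol a b z c0 c1 (Suc 0) = c1"
| "jacobi_sol a b z c0 c1 (Suc (Suc n)) =
     ((z - b (Suc n)) * jacobi_sol a b z c0 c1 (Suc n) - a n * jacobi_sol a b z c0 c1 n)
       / a (Suc n)"

definition f_minus :: "(nat \<Rightarrow> real) \<Rightarrow> (nat \<Rightarrow> real) \<Rightarrow> nat \<Rightarrow> complex \<Rightarrow> complex" where
  "f_minus a b n z = jacobi_sol a b z 0 1 n"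

definition f_plus :: "(nat \<Rightarrow> real) \<Rightarrow> (nat \<Rightarrow> real) \<Rightarrow> nat \<Rightarrow> complex \<Rightarrow> complex" where
  "f_plus a b n z = jacobi_sol a b z 1 (- green a b 1 z) n"

text \<open>The principal branch \<^const>\<open>Ln\<close> has imaginary part in \<open>(0, \<pi>)\<close> on the upper half plane.\<close>

definition w_plus :: "(nat \<Rightarrow> real) \<Rightarrow> (nat \<Rightarrow> real) \<Rightarrow> nat \<Rightarrow> complex \<Rightarrow> complex" where
  "w_plus a b N z = (\<Sum>n=1..N. Ln (- (f_plus a b (n + 1) z / f_plus a b n z))) / of_nat N"

definition w_minus :: "(nat \<Rightarrow> real) \<Rightarrow> (nat \<Rightarrow> real) \<Rightarrow> nat \<Rightarrow> complex \<Rightarrow> complex" where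
  "w_minus a b N z = (\<Sum>n=1..N. Ln (f_minus a b (n + 1) z / f_minus a b n z)) / of_nat N"

definition g_avg :: "(nat \<Rightarrow> real) \<Rightarrow> (nat \<Rightarrow> real) \<Rightarrow> nat \<Rightarrow> complex \<Rightarrow> complex" where
  "g_avg a b N z = (\<Sum>n=1..N. green a b n z) / of_nat N"

definition ell2_projection :: "((nat \<Rightarrow> complex) \<Rightarrow> (nat \<Rightarrow> complex)) \<Rightarrow> bool" where
  "ell2_projection P \<longleftrightarrow>
     (\<forall>u\<in>ell2. P u \<in> ell2 \<and> P (P u) = P u) \<and>
     (\<forall>u\<in>ell2. \<forall>v\<in>ell2. \<forall>c. P (\<lambda>n. c * u n + v n) = (\<lambda>n. c * P u n + P v n)) \<and>
     (\<forall>u\<in>ell2. \<forall>v\<in>ell2. ell2_inner (P u) v = ell2_inner u (P v))"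

text \<open>\<open>E t\<close> is the spectral projection of \<open>T\<close> for \<open>(-\<infinity>, t]\<close>; the last clause is
  \<open>T = \<integral> t dE(t)\<close>, read through quadratic forms (\<open>T\<close> is bounded and everywhere defined).\<close>

definition spectral_resolution ::
  "((nat \<Rightarrow> complex) \<Rightarrow> (nat \<Rightarrow> complex)) \<Rightarrow> (real \<Rightarrow> (nat \<Rightarrow> complex) \<Rightarrow> (nat \<Rightarrow> complex)) \<Rightarrow> bool"
  where
  "spectral_resolution T E \<longleftrightarrow>
     (\<forall>t. ell2_projection (E t)) \<and>
     (\<forall>s t. s \<le> t \<longrightarrow> (\<forall>u\<in>ell2. E s (E t u) = E s u \<and> E t (E s u) = E s u)) \<and>
     (\<forall>t. \<forall>u\<in>ell2. ((\<lambda>s. ell2_norm (\<lambda>n. E s u n - E t u n)) \<longlongrightarrow> 0) (at_right t)) \<and>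
     (\<forall>u\<in>ell2. ((\<lambda>t. ell2_norm (E t u)) \<longlongrightarrow> 0) at_bot) \<and>
     (\<forall>u\<in>ell2. ((\<lambda>t. ell2_norm (\<lambda>n. E t u n - u n)) \<longlongrightarrow> 0) at_top) \<and>
     (\<forall>u\<in>ell2. has_bochner_integral (interval_measure (\<lambda>t. (ell2_norm (E t u))\<^sup>2))
                  complex_of_real (ell2_inner u (T u)))"

definition nu_measure ::
  "(real \<Rightarrow> (nat \<Rightarrow> complex) \<Rightarrow> (nat \<Rightarrow> complex)) \<Rightarrow> nat \<Rightarrow> real measure" where
  "nu_measure E N =
     interval_measure (\<lambda>t. (\<Sum>n=1..N. (ell2_norm (E t (delta n)))\<^sup>2) / real N)"

text \<open>Matrix indices start at 0, so that row \<open>i\<close> corresponds to site \<open>i + 1\<close>.\<close>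

definition jacobi_truncation :: "(nat \<Rightarrow> real) \<Rightarrow> (nat \<Rightarrow> real) \<Rightarrow> nat \<Rightarrow> real Matrix.mat" where
  "jacobi_truncation a b N = Matrix.mat N N
     (\<lambda>(i, j). if i = j then b (i + 1)
               else if j = i + 1 then a (i + 1)
               else if i = j + 1 then a (j + 1)
               else 0)"

text \<open>The uniform measure on the eigenvalues, counted with multiplicity. The matrix is real
  symmetric, so all \<open>N\<close> roots of its characteristic polynomial are real.\<close>

definition dk_measure :: "(nat \<Rightarrow> real) \<Rightarrow> (nat \<Rightarrow> real) \<Rightarrow> nat \<Rightarrow> real measure" where
  "dk_measure a b N =
     distr (measure_pmf (pmf_of_multiset (proots (char_poly (jacobi_truncation a b N)))))
       borel (\<lambda>x. x)"

definition weak_star_lim :: "(nat \<Rightarrow> real measure) \<Rightarrow> real measure \<Rightarrow> bool" where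
  "weak_star_lim M \<mu> \<longleftrightarrow>
     (\<forall>f :: real \<Rightarrow> real. continuous_on UNIV f \<longrightarrow> compact (closure {x. f x \<noteq> 0}) \<longrightarrow>
        (\<lambda>j. integral\<^sup>L (M j) f) \<longlonglongrightarrow> integral\<^sup>L \<mu> f)"

definition upper_half_plane :: "complex set" where
  "upper_half_plane = {z. Im z > 0}"

definition herglotz :: "(complex \<Rightarrow> complex) \<Rightarrow> bool" where
  "herglotz F \<longleftrightarrow> F holomorphic_on upper_half_plane \<and> F ` upper_half_plane \<subseteq> upper_half_plane"

definition loc_uniform_lim :: "(nat \<Rightarrow> complex \<Rightarrow> complex) \<Rightarrow> (complex \<Rightarrow> complex) \<Rightarrow> bool" where
  "loc_uniform_lim F G \<longleftrightarrow>
     (\<forall>K. compact K \<longrightarrow> K \<subseteq> upper_half_plane \<longrightarrow> uniform_limit K F G sequentially)"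

text \<open>Boundary value of \<open>\<gamma> = - Re w\<^sub>+\<close>.\<close>

definition lyapunov :: "(complex \<Rightarrow> complex) \<Rightarrow> real \<Rightarrow> real" where
  "lyapunov wp t = Lim (at_right 0) (\<lambda>y. - Re (wp (Complex t y)))"

definition deviation_set :: "real \<Rightarrow> real \<Rightarrow> (real \<Rightarrow> real) \<Rightarrow> real set" where
  "deviation_set x \<epsilon> \<gamma> = {y. \<bar>\<gamma> y - \<gamma> x\<bar> \<ge> \<epsilon>}"

end

theory Submission
  imports Defs
begin

text \<open>
  The Lyapunov exponent is a logarithmic potential up to a constant. For \<open>Im z > 0\<close> the
  Wronskian of \<open>f_-\<close> and \<open>f_+\<close> is 1, and this keeps \<open>\<bar>f_-(n) f_+(n)\<bar>\<close> between two positive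
  constants that depend on \<open>z\<close> only. Hence \<open>- Re w\<^sub>+\<close> is the limit of \<open>(1/N) ln \<bar>f_-(N+1)\<bar>\<close>
  along the given sequence. Up to the factor \<open>a(1) \<dots> a(N)\<close>, the function \<open>f_-(N+1)\<close> is a monic
  polynomial of degree \<open>N\<close> whose zeros are real and lie in a fixed interval. A weak limit \<open>\<kappa>\<close> of the
  normalized zero counting measures gives the Thouless formula
  \<open>- Re w\<^sub>+(z) = \<integral> ln \<bar>z - t\<bar> d\<kappa>(t) - ln A\<close> on the upper half plane (\<open>limit_is_log_potential\<close>).
  Because \<open>f_+\<close> is square summable, \<open>- Re w\<^sub>+ \<ge> 0\<close> (\<open>limit_Re_nonpos\<close>). The potential is therefore
  bounded below by \<open>ln A\<close>, this bound survives on the real line, and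
  \<open>\<gamma>(y) = p(y) - ln A\<close> with \<open>p(y) = \<integral> ln \<bar>y - t\<bar> d\<kappa>(t) \<ge> ln A\<close> for every real \<open>y\<close>
  (\<open>boundary_potential\<close>).

  Everything else is a local statement about such potentials (\<open>deviation_capacity_small\<close>). Fix \<open>x\<close>,
  take a small \<open>\<delta>\<close>, and compare \<open>p(y)\<close> with \<open>p(x)\<close> for \<open>\<bar>y - x\<bar> < h = \<delta>\<^sup>2\<close>. The part of \<open>\<kappa>\<close> outside
  \<open>I = (x - \<delta>, x + \<delta>)\<close> contributes at most \<open>2 \<delta>\<close> to \<open>p(y) - p(x)\<close>. Let \<open>\<tau>\<close> be the restriction of
  \<open>\<kappa>\<close> to \<open>I\<close> and \<open>U(y) = \<integral> - ln \<bar>y - t\<bar> d\<tau>(t) \<ge> 0\<close>. Since \<open>p(x)\<close> is finite, \<open>U(x)\<close> tends to 0 with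
  \<open>\<delta>\<close>; so \<open>p\<close> cannot exceed \<open>p(x) + \<epsilon>\<close> nearby, and \<open>U \<ge> \<epsilon>/2\<close> on the deviation set. Also \<open>U \<le> C\<close> on
  \<open>I\<close>, because \<open>p\<close> is bounded below, and the mass \<open>m\<close> of \<open>\<tau>\<close> satisfies \<open>m ln (1/\<delta>) \<le> U(x) \<rightarrow> 0\<close>.

  Now let \<open>\<mu>\<close> be a probability measure carried by the deviation set near \<open>x\<close>. On sets of diameter at
  most 1 the kernel \<open>- ln \<bar>s - t\<bar>\<close> agrees, up to a bounded error, with a kernel of the form
  \<open>\<integral> \<phi>\<^sub>q(s) \<phi>\<^sub>q(t) dq\<close>, for which the Cauchy-Schwarz inequality holds between mutual energies. It
  yields \<open>(\<epsilon>/4)\<^sup>2 \<le> - I(\<mu>) * C m\<close> (\<open>energy_lower_bound\<close>). As \<open>m = o(1 / ln (1/\<delta>))\<close>, the energy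
  \<open>- I(\<mu>)\<close> eventually exceeds every multiple of \<open>ln (1/\<delta>)\<close>, so the capacity \<open>exp (I(\<mu>))\<close> is smaller than
  every power of \<open>\<delta>\<close>, hence than every power of \<open>h\<close>.
\<close>

section \<open>Solutions of the Jacobi recurrence\<close>

locale bounded_jacobi =
  fixes a b :: "nat \<Rightarrow> real" and M :: real
  assumes M_pos: "M > 0"
    and a_bounds: "\<And>n. n \<ge> 1 \<Longrightarrow> 1 / (M + 1) \<le> a n \<and> a n \<le> M + 1"
    and b_bound: "\<And>n. n \<ge> 1 \<Longrightarrow> \<bar>b n\<bar> \<le> M"
    and a_0: "a 0 = 1"
begin

lemma a_pos: "a n > 0"
proof (cases "n = 0")
  case False
  then have "1 / (M + 1) \<le> a n" using a_bounds by simp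
  moreover have "1 / (M + 1) > 0" using M_pos by simp
  ultimately show ?thesis by linarith
qed (simp add: a_0)

lemma a_le: "a n \<le> M + 1"
  using a_bounds[of n] a_0 M_pos by (cases "n = 0") auto

definition solves :: "complex \<Rightarrow> (nat \<Rightarrow> complex) \<Rightarrow> bool" where
  "solves z f \<longleftrightarrow>
     (\<forall>n. of_real (a (Suc n)) * f (Suc (Suc n)) + of_real (a n) * f n + of_real (b (Suc n)) * f (Suc n)
          = z * f (Suc n))"

text \<open>The imaginary part of the Wronskian of a solution with its complex conjugate. Its increments have a
  sign in the upper half plane, and this drives all estimates of the solutions.\<close>

definition flux :: "(nat \<Rightarrow> complex) \<Rightarrow> nat \<Rightarrow> real" where
  "flux f n = a n * Im (f (Suc n) * cnj (f n))"

lemma solves_jacobi_sol: "solves z (jacobi_sol a b z c d)"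
  using a_pos by (simp add: solves_def field_simps less_imp_neq[symmetric])

lemma solves_unique:
  assumes "solves z f" "solves z g" "f 0 = g 0" "f (Suc 0) = g (Suc 0)"
  shows "f = g"
proof -
  have "f n = g n \<and> f (Suc n) = g (Suc n)" for n
  proof (induction n)
    case (Suc n)
    have "a (Suc n) * f (Suc (Suc n)) = a (Suc n) * g (Suc (Suc n))"
      using assms(1,2) Suc unfolding solves_def by (metis add_right_cancel)
    then show ?case using Suc a_pos[of "Suc n"] by simp
  qed (use assms in simp)
  then show ?thesis by auto
qed

lemma solves_add_mult:
  assumes "solves z f" "solves z g"
  shows "solves z (\<lambda>n. f n + c * g n)"
  unfolding solves_def
proof
  fix n
  let ?L = "\<lambda>h. of_real (a (Suc n)) * h (Suc (Suc n)) + of_real (a n) * h n + of_real (b (Suc n)) * h (Suc n)"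
  have "?L (\<lambda>n. f n + c * g n) = ?L f + c * ?L g" by (simp add: algebra_simps)
  also have "\<dots> = z * f (Suc n) + c * (z * g (Suc n))" using assms by (simp add: solves_def)
  finally show "?L (\<lambda>n. f n + c * g n) = z * (f (Suc n) + c * g (Suc n))"
    by (simp add: algebra_simps)
qed

lemma solves_Suc:
  assumes "solves z f"
  shows "of_real (a (Suc n)) * f (Suc (Suc n)) = (z - of_real (b (Suc n))) * f (Suc n) - of_real (a n) * f n"
  using assms unfolding solves_def by (simp add: algebra_simps eq_diff_eq)

text \<open>Multiply the recurrence by the conjugate of \<open>f (Suc n)\<close> and take imaginary parts: the coefficients
  are real, so only \<open>Im z\<close> survives.\<close>

lemma flux_Suc:
  assumes "solves z f"
  shows "flux f (Suc n) = flux f n + Im z * (cmod (f (Suc n)))\<^sup>2"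
proof -
  have "flux f (Suc n) = Im ((a (Suc n) * f (Suc (Suc n))) * cnj (f (Suc n)))"
    by (simp add: flux_def algebra_simps)
  also have "\<dots> = Im ((z - b (Suc n)) * (f (Suc n) * cnj (f (Suc n)))) - Im (a n * f n * cnj (f (Suc n)))"
    unfolding solves_Suc[OF assms] by (simp add: algebra_simps)
  also have "\<dots> = Im z * (cmod (f (Suc n)))\<^sup>2 + flux f n"
    by (subst complex_norm_square[symmetric]) (simp add: flux_def algebra_simps)
  finally show ?thesis by simp
qed

lemma flux_sum:
  assumes "solves z f"
  shows "flux f n = flux f 0 + Im z * (\<Sum>k=1..n. (cmod (f k))\<^sup>2)"
  by (induction n) (simp_all add: flux_Suc[OF assms] algebra_simps)

lemma flux_le: "\<bar>flux f n\<bar> \<le> (M + 1) * (cmod (f (Suc n)) * cmod (f n))"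
proof -
  have "\<bar>flux f n\<bar> = a n * \<bar>Im (f (Suc n) * cnj (f n))\<bar>"
    using a_pos[of n] by (simp add: flux_def abs_mult)
  also have "\<dots> \<le> (M + 1) * cmod (f (Suc n) * cnj (f n))"
    using a_pos[of n] a_le[of n] by (intro mult_mono abs_Im_le_cmod) auto
  finally show ?thesis by (simp add: norm_mult)
qed

lemma solves_f_minus: "solves z (\<lambda>n. f_minus a b n z)"
  using solves_jacobi_sol by (simp add: f_minus_def)

lemma f_minus_0 [simp]: "f_minus a b 0 z = 0" and f_minus_1 [simp]: "f_minus a b (Suc 0) z = 1"
  by (simp_all add: f_minus_def)

lemma flux_f_minus: "flux (\<lambda>n. f_minus a b n z) n = Im z * (\<Sum>k=1..n. (cmod (f_minus a b k z))\<^sup>2)"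
  using flux_sum[OF solves_f_minus] by (simp add: flux_def[where n=0])

text \<open>The flux of \<open>f_-\<close> starts at 0 and gains at least \<open>Im z\<close> at the first site, so it never vanishes
  again; a zero of \<open>f_-\<close> would make it vanish. This applies on both sides of the real axis, so all zeros of
  \<open>f_-\<close> as a function of \<open>z\<close> are real.\<close>

lemma f_minus_nonzero:
  assumes "Im z \<noteq> 0"
  shows "f_minus a b (Suc n) z \<noteq> 0"
proof (cases n)
  case (Suc m)
  have "1 \<le> (\<Sum>k=1..n. (cmod (f_minus a b k z))\<^sup>2)"
    using member_le_sum[of 1 "{1..n}" "\<lambda>k. (cmod (f_minus a b k z))\<^sup>2"] Suc by simp
  then have "flux (\<lambda>n. f_minus a b n z) n \<noteq> 0"
    using assms by (auto simp: flux_f_minus)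
  then show ?thesis by (auto simp: flux_def)
qed simp

text \<open>Weyl's argument. The solution with \<open>f(0) = 1\<close> and \<open>f(N+1) = 0\<close> has zero flux at \<open>N\<close>, hence
  \<open>Im z * (\<Sum>k=1..N. \<bar>f(k)\<bar>\<^sup>2) = - Im f(1)\<close>. This bounds \<open>f(1)\<close> and the sum independently of \<open>N\<close>, and a limit
  point of the values \<open>f(1)\<close> gives a square summable solution.\<close>

lemma weyl_solution_exists:
  assumes "Im z > 0"
  shows "\<exists>f. solves z f \<and> f 0 = 1 \<and> summable (\<lambda>n. (cmod (f n))\<^sup>2)"
proof -
  define \<theta> where "\<theta> = jacobi_sol a b z 1 0"
  define \<phi> where "\<phi> n = f_minus a b n z" for n
  define \<psi> where "\<psi> m n = \<theta> n + m * \<phi> n" for m n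
  define m where "m N = - \<theta> (Suc N) / \<phi> (Suc N)" for N
  have sol: "solves z (\<psi> c)" for c
    unfolding \<psi>_def \<theta>_def \<phi>_def by (intro solves_add_mult solves_jacobi_sol solves_f_minus)
  have \<psi>0: "\<psi> c 0 = 1" and \<psi>1: "\<psi> c (Suc 0) = c" for c
    by (simp_all add: \<psi>_def \<theta>_def \<phi>_def)
  have "\<psi> (m N) (Suc N) = 0" for N
    using f_minus_nonzero[of z N] assms by (simp add: \<psi>_def m_def \<phi>_def)
  \<comment> \<open>The boundary term at 0 is \<open>a 0 = 1\<close> times the imaginary part of \<open>\<psi> (m N) 1 = m N\<close>.\<close>
  then have sum_eq: "Im z * (\<Sum>k=1..N. (cmod (\<psi> (m N) k))\<^sup>2) = - Im (m N)" for N
    using flux_sum[OF sol, of "m N" N] by (simp add: flux_def \<psi>0 \<psi>1 a_0)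
  have m_bound: "cmod (m N) \<le> 1 / Im z" if "N \<ge> 1" for N
  proof -
    have "(cmod (m N))\<^sup>2 \<le> (\<Sum>k=1..N. (cmod (\<psi> (m N) k))\<^sup>2)"
      using member_le_sum[of 1 "{1..N}" "\<lambda>k. (cmod (\<psi> (m N) k))\<^sup>2"] that \<psi>1 by simp
    then have "Im z * (cmod (m N))\<^sup>2 \<le> - Im (m N)"
      using assms by (subst sum_eq[symmetric]) (intro mult_left_mono, auto)
    also have "\<dots> \<le> cmod (m N)" using abs_Im_le_cmod[of "m N"] by linarith
    finally have "cmod (m N) * (Im z * cmod (m N)) \<le> cmod (m N) * 1" by (simp add: power2_eq_square algebra_simps)
    then have "m N = 0 \<or> Im z * cmod (m N) \<le> 1" 
      using zero_less_norm_iff[of "m N"] by (metis mult_le_cancel_left_pos)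
    then show ?thesis using assms by (auto simp: field_simps)
  qed
  have "bounded (range (\<lambda>N. m (Suc N)))"
    using m_bound by (intro boundedI[where B = "1 / Im z"]) auto
  then obtain c r where r: "strict_mono r" "((\<lambda>N. m (Suc N)) \<circ> r) \<longlonglongrightarrow> c"
    using bounded_imp_convergent_subsequence by blast
  have partial: "(\<Sum>k=1..K. (cmod (\<psi> c k))\<^sup>2) \<le> 1 / (Im z)\<^sup>2" for K
  proof (rule LIMSEQ_le_const2)
    show "(\<lambda>j. \<Sum>k=1..K. (cmod (\<psi> (m (Suc (r j))) k))\<^sup>2) \<longlonglongrightarrow> (\<Sum>k=1..K. (cmod (\<psi> c k))\<^sup>2)"
      unfolding \<psi>_def using r(2) by (intro tendsto_intros) (simp add: o_def)
    show "\<exists>N. \<forall>j\<ge>N. (\<Sum>k=1..K. (cmod (\<psi> (m (Suc (r j))) k))\<^sup>2) \<le> 1 / (Im z)\<^sup>2"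
    proof (intro exI allI impI)
      fix j assume "K \<le> j"
      then have "K \<le> Suc (r j)" using seq_suble[OF r(1), of j] by linarith
      then have "(\<Sum>k=1..K. (cmod (\<psi> (m (Suc (r j))) k))\<^sup>2)
          \<le> (\<Sum>k=1..Suc (r j). (cmod (\<psi> (m (Suc (r j))) k))\<^sup>2)"
        by (intro sum_mono2) auto
      also have "\<dots> = - Im (m (Suc (r j))) / Im z"
        using sum_eq[of "Suc (r j)"] assms by (simp add: field_simps)
      also have "\<dots> \<le> (1 / Im z) / Im z"
        using m_bound[of "Suc (r j)"] abs_Im_le_cmod[of "m (Suc (r j))"] assms
        by (intro divide_right_mono) auto
      finally show "(\<Sum>k=1..K. (cmod (\<psi> (m (Suc (r j))) k))\<^sup>2) \<le> 1 / (Im z)\<^sup>2"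
        by (simp add: power2_eq_square)
    qed
  qed
  have "summable (\<lambda>n. (cmod (\<psi> c (Suc n)))\<^sup>2)"
  proof (rule summableI_nonneg_bounded)
    fix n show "(\<Sum>i<n. (cmod (\<psi> c (Suc i)))\<^sup>2) \<le> 1 / (Im z)\<^sup>2"
      using partial[of n] by (simp add: sum.atLeast1_atMost_eq)
  qed simp
  then have "summable (\<lambda>n. (cmod (\<psi> c n))\<^sup>2)"
    using summable_Suc_iff[of "\<lambda>n. (cmod (\<psi> c n))\<^sup>2"] by blast
  then show ?thesis using sol \<psi>0 by blast
qed

text \<open>The resolvent is a choice among preimages of \<open>\<delta>\<^sub>1\<close> in \<open>\<ell>\<^sup>2\<close>. A square summable solution
  shows that such preimages exist; any of them is, up to sign, the restriction to \<open>n \<ge> 1\<close> of a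
  square summable solution with value 1 at site 0.\<close>

lemma f_plus_is_weyl:
  assumes "Im z > 0"
  shows "solves z (\<lambda>n. f_plus a b n z)" "f_plus a b 0 z = 1"
    "summable (\<lambda>n. (cmod (f_plus a b n z))\<^sup>2)"
proof -
  let ?T = "\<lambda>u n. jacobi_op a b u n - z * u n"
  obtain f where f: "solves z f" "f 0 = 1" "summable (\<lambda>n. (cmod (f n))\<^sup>2)"
    using weyl_solution_exists[OF assms] by blast
  define v where "v n = (if n = 0 then 0 else - f n)" for n
  have v_ell2: "v \<in> ell2"
  proof -
    have "(\<lambda>n. (cmod (v (Suc n)))\<^sup>2) = (\<lambda>n. (cmod (f (Suc n)))\<^sup>2)" by (auto simp: v_def)
    then have "summable (\<lambda>n. (cmod (v (Suc n)))\<^sup>2)"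
      using f(3) summable_Suc_iff[of "\<lambda>n. (cmod (f n))\<^sup>2"] by simp
    then show ?thesis using summable_Suc_iff[of "\<lambda>n. (cmod (v n))\<^sup>2"]
      by (simp add: ell2_def v_def)
  qed
  have v_eq: "?T v = delta 1"
  proof
    fix n show "?T v n = delta 1 n"
    proof (cases n)
      case 0 then show ?thesis by (simp add: jacobi_op_def delta_def v_def)
    next
      case (Suc k)
      have "(if k = 0 then 0 else a k * v k) = delta 1 (Suc k) - a k * f k"
        using f(2) a_0 by (simp add: v_def delta_def)
      moreover have "?T v n = a (Suc k) * v (Suc (Suc k)) + (if k = 0 then 0 else a k * v k)
          + b (Suc k) * v (Suc k) - z * v (Suc k)"
        by (simp add: jacobi_op_def Suc)
      ultimately have "?T v n = delta 1 n + z * f (Suc k)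
          - (a (Suc k) * f (Suc (Suc k)) + a k * f k + b (Suc k) * f (Suc k))"
        by (simp only:) (simp add: v_def Suc)
      also have "\<dots> = delta 1 n" using f(1) by (simp add: solves_def)
      finally show ?thesis .
    qed
  qed
  have ran: "delta 1 \<in> ?T ` ell2" using image_eqI[of "delta 1" ?T v ell2] v_eq v_ell2 by simp
  define u where "u = resolvent a b z (delta 1)"
  have u: "u \<in> ell2" "?T u = delta 1"
    using inv_into_into[OF ran] f_inv_into_f[OF ran] by (simp_all add: u_def resolvent_def)
  have "(\<lambda>n. cnj (delta 1 n) * u n) = (\<lambda>n. if n = 1 then u n else 0)"
    by (auto simp: delta_def)
  then have "(\<lambda>n. cnj (delta 1 n) * u n) sums u 1"
    using sums_single[of 1 u] by (simp only:)
  then have green: "green a b 1 z = u 1"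
    unfolding green_def ell2_inner_def u_def by (rule sums_unique[symmetric])
  define F where "F n = (if n = 0 then 1 else - u n)" for n
  have cancel: "x = y" if "d + y - x = d" for x y d :: complex
    using that by (metis add_diff_cancel_left' add_diff_eq right_minus_eq)
  have "solves z F"
    unfolding solves_def
  proof
    fix k
    have "(if k = 0 then 0 else a k * u k) = delta 1 (Suc k) - a k * F k"
      using a_0 by (simp add: F_def delta_def)
    moreover have "?T u (Suc k) = a (Suc k) * u (Suc (Suc k)) + (if k = 0 then 0 else a k * u k)
        + b (Suc k) * u (Suc k) - z * u (Suc k)"
      by (simp add: jacobi_op_def)
    ultimately have "?T u (Suc k) = delta 1 (Suc k) + z * F (Suc k)
        - (a (Suc k) * F (Suc (Suc k)) + a k * F k + b (Suc k) * F (Suc k))"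
      by (simp only:) (simp add: F_def)
    moreover have "?T u (Suc k) = delta 1 (Suc k)" using u(2) by (rule fun_cong)
    ultimately have "delta 1 (Suc k) + z * F (Suc k)
        - (a (Suc k) * F (Suc (Suc k)) + a k * F k + b (Suc k) * F (Suc k)) = delta 1 (Suc k)"
      by (simp only:)
    then show "a (Suc k) * F (Suc (Suc k)) + a k * F k + b (Suc k) * F (Suc k) = z * F (Suc k)"
      by (rule cancel)
  qed
  then have "F = jacobi_sol a b z 1 (- green a b 1 z)"
    using solves_jacobi_sol by (rule solves_unique) (simp_all only: F_def jacobi_sol.simps green, simp_all)
  then have F: "F = (\<lambda>n. f_plus a b n z)" by (simp add: f_plus_def fun_eq_iff)
  show "solves z (\<lambda>n. f_plus a b n z)" "f_plus a b 0 z = 1"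
    using \<open>solves z F\<close> unfolding F by (simp_all add: f_plus_def)
  have "(\<lambda>n. (cmod (F (Suc n)))\<^sup>2) = (\<lambda>n. (cmod (u (Suc n)))\<^sup>2)" by (auto simp: F_def)
  then have "summable (\<lambda>n. (cmod (F n))\<^sup>2)"
    using u(1) summable_Suc_iff[of "\<lambda>n. (cmod (u n))\<^sup>2"] summable_Suc_iff[of "\<lambda>n. (cmod (F n))\<^sup>2"]
    by (simp add: ell2_def)
  then show "summable (\<lambda>n. (cmod (f_plus a b n z))\<^sup>2)" by (simp add: F)
qed

lemma flux_f_minus_ge:
  assumes "Im z \<ge> 0"
  shows "Im z * (cmod (f_minus a b n z))\<^sup>2 \<le> flux (\<lambda>n. f_minus a b n z) n"
proof (cases "n = 0")
  case False
  then have "(cmod (f_minus a b n z))\<^sup>2 \<le> (\<Sum>k=1..n. (cmod (f_minus a b k z))\<^sup>2)"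
    using member_le_sum[of n "{1..n}" "\<lambda>k. (cmod (f_minus a b k z))\<^sup>2"] by simp
  then show ?thesis using assms by (simp add: flux_f_minus mult_left_mono)
qed (simp add: flux_f_minus)

lemma f_plus_tendsto_0:
  assumes "Im z > 0"
  shows "(\<lambda>n. cmod (f_plus a b n z)) \<longlonglongrightarrow> 0"
  using tendsto_real_sqrt[OF summable_LIMSEQ_zero[OF f_plus_is_weyl(3)[OF assms]]] by simp

text \<open>The flux of \<open>f_+\<close> is increasing and tends to 0 because \<open>f_+\<close> is square summable, so it is
  nonpositive; the next increment then bounds it from above.\<close>

lemma flux_f_plus_le:
  assumes "Im z > 0"
  shows "flux (\<lambda>n. f_plus a b n z) n \<le> - (Im z * (cmod (f_plus a b (Suc n) z))\<^sup>2)"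
proof -
  let ?f = "\<lambda>n. f_plus a b n z"
  note step = flux_Suc[OF f_plus_is_weyl(1)[OF assms]]
  have "incseq (flux ?f)"
    by (rule incseq_SucI) (use step assms in simp)
  moreover have "flux ?f \<longlonglongrightarrow> 0"
  proof (rule tendsto_rabs_zero_cancel, rule tendsto_sandwich[OF _ _ tendsto_const])
    note lim = f_plus_tendsto_0[OF assms]
    have "(\<lambda>n. (M + 1) * (cmod (?f (Suc n)) * cmod (?f n))) \<longlonglongrightarrow> (M + 1) * (0 * 0)"
      by (intro tendsto_mult tendsto_const lim LIMSEQ_Suc[OF lim])
    then show "(\<lambda>n. (M + 1) * (cmod (?f (Suc n)) * cmod (?f n))) \<longlonglongrightarrow> 0" by simp
  qed (auto intro!: always_eventually flux_le)
  ultimately have "flux ?f (Suc n) \<le> 0" by (rule incseq_le)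
  then show ?thesis using step[of n] by simp
qed

lemma wronskian_const:
  assumes "solves z f" "solves z g"
  shows "of_real (a n) * (f (Suc n) * g n - f n * g (Suc n)) = f (Suc 0) * g 0 - f 0 * g (Suc 0)"
proof (induction n)
  case (Suc n)
  have "of_real (a (Suc n)) * (f (Suc (Suc n)) * g (Suc n) - f (Suc n) * g (Suc (Suc n)))
      = (of_real (a (Suc n)) * f (Suc (Suc n))) * g (Suc n) - f (Suc n) * (of_real (a (Suc n)) * g (Suc (Suc n)))"
    by (simp add: algebra_simps)
  also have "\<dots> = of_real (a n) * (f (Suc n) * g n - f n * g (Suc n))"
    unfolding solves_Suc[OF assms(1)] solves_Suc[OF assms(2)] by (simp add: algebra_simps)
  finally show ?case using Suc by simp
qed (simp add: a_0)

lemma wronskian_f: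
  assumes "Im z > 0"
  shows "of_real (a n) * (f_minus a b (Suc n) z * f_plus a b n z - f_minus a b n z * f_plus a b (Suc n) z) = 1"
  using wronskian_const[OF solves_f_minus f_plus_is_weyl(1)[OF assms], of n] f_plus_is_weyl(2)[OF assms]
  by simp

text \<open>A zero of \<open>f_+\<close> at \<open>n\<close> makes the flux vanish at \<open>n\<close>, which forces a second zero at \<open>n + 1\<close>
  and contradicts the Wronskian identity.\<close>

lemma f_plus_nonzero:
  assumes "Im z > 0"
  shows "f_plus a b n z \<noteq> 0"
proof
  assume 0: "f_plus a b n z = 0"
  then have "flux (\<lambda>n. f_plus a b n z) n = 0" by (simp add: flux_def)
  then have "f_plus a b (Suc n) z = 0"
    using flux_f_plus_le[OF assms, of n] assms by (simp add: mult_le_0_iff)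
  then show False using wronskian_f[OF assms, of n] 0 by simp
qed

lemma f_plus_Suc_le:
  assumes "Im z > 0"
  shows "Im z * cmod (f_plus a b (Suc n) z) \<le> (M + 1) * cmod (f_plus a b n z)"
proof -
  have "Im z * (cmod (f_plus a b (Suc n) z))\<^sup>2 \<le> (M + 1) * (cmod (f_plus a b (Suc n) z) * cmod (f_plus a b n z))"
    using flux_f_plus_le[OF assms, of n] flux_le[of "\<lambda>n. f_plus a b n z" n] by linarith
  then have "cmod (f_plus a b (Suc n) z) * (Im z * cmod (f_plus a b (Suc n) z))
      \<le> cmod (f_plus a b (Suc n) z) * ((M + 1) * cmod (f_plus a b n z))"
    by (simp add: power2_eq_square algebra_simps)
  then show ?thesis using f_plus_nonzero[OF assms, of "Suc n"] by (simp add: mult_le_cancel_left_pos)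
qed

lemma f_minus_le_Suc:
  assumes "Im z > 0"
  shows "Im z * cmod (f_minus a b n z) \<le> (M + 1) * cmod (f_minus a b (Suc n) z)"
proof (cases "f_minus a b n z = 0")
  case True then show ?thesis using M_pos by simp
next
  case False
  have "Im z * (cmod (f_minus a b n z))\<^sup>2 \<le> (M + 1) * (cmod (f_minus a b (Suc n) z) * cmod (f_minus a b n z))"
    using flux_f_minus_ge[of z n] assms flux_le[of "\<lambda>n. f_minus a b n z" n] by linarith
  then have "cmod (f_minus a b n z) * (Im z * cmod (f_minus a b n z))
      \<le> cmod (f_minus a b n z) * ((M + 1) * cmod (f_minus a b (Suc n) z))"
    by (simp add: power2_eq_square algebra_simps)
  then show ?thesis using False by (simp add: mult_le_cancel_left_pos)
qed

text \<open>By the Wronskian identity, \<open>1 / (f_- f_+)\<close> is \<open>a\<close> times the difference of the ratios of \<open>f_-\<close> and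
  \<open>f_+\<close> at consecutive sites. The flux estimates make the imaginary part of that difference at
  least \<open>Im z / a\<close>.\<close>

lemma f_product_upper:
  assumes "Im z > 0"
  shows "cmod (f_minus a b (Suc n) z * f_plus a b (Suc n) z) \<le> 1 / Im z"
proof -
  let ?n = "Suc n"
  let ?p = "f_minus a b ?n z" and ?p' = "f_minus a b (Suc ?n) z"
  let ?q = "f_plus a b ?n z" and ?q' = "f_plus a b (Suc ?n) z"
  have nz: "?p \<noteq> 0" "?q \<noteq> 0" using f_minus_nonzero f_plus_nonzero assms by auto
  have Im_ratio: "a ?n * Im (f (Suc ?n) / f ?n) = flux f ?n / (cmod (f ?n))\<^sup>2" for f
    by (subst complex_div_cnj) (simp add: flux_def Im_divide_of_real)
  have "Im z \<le> a ?n * Im (?p' / ?p)"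
    using flux_f_minus_ge[of z ?n] assms nz by (simp add: Im_ratio[of "\<lambda>n. f_minus a b n z"] field_simps)
  moreover have "a ?n * Im (?q' / ?q) \<le> 0"
  proof -
    have "flux (\<lambda>n. f_plus a b n z) ?n \<le> 0"
      using flux_f_plus_le[OF assms, of ?n] assms by (smt (verit) mult_nonneg_nonneg zero_le_power2)
    then show ?thesis by (simp add: Im_ratio[of "\<lambda>n. f_plus a b n z"] divide_nonpos_nonneg)
  qed
  moreover have "1 / (?p * ?q) = of_real (a ?n) * (?p' / ?p - ?q' / ?q)"
    using wronskian_f[OF assms, of ?n] nz by (simp add: field_simps)
  then have "Im (1 / (?p * ?q)) = a ?n * Im (?p' / ?p) - a ?n * Im (?q' / ?q)"
    by (simp only: Im_complex_of_real Re_complex_of_real times_complex.sel minus_complex.sel) (simp add: algebra_simps)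
  ultimately have "Im z \<le> cmod (1 / (?p * ?q))"
    using abs_Im_le_cmod[of "1 / (?p * ?q)"] by linarith
  then show ?thesis using nz assms by (simp add: norm_divide field_simps)
qed

text \<open>Both ratios in the Wronskian identity are bounded: that of \<open>f_+\<close> directly by its flux, that of
  \<open>f_-\<close> by the recurrence, since the flux of \<open>f_-\<close> bounds the reciprocal of the preceding ratio.\<close>

lemma f_product_lower:
  assumes "Im z > 0"
  shows "1 \<le> (cmod z + M + 2 * (M + 1)\<^sup>2 / Im z) * cmod (f_minus a b (Suc n) z * f_plus a b (Suc n) z)"
proof -
  let ?n = "Suc n"
  let ?p = "cmod (f_minus a b ?n z)" and ?p' = "cmod (f_minus a b (Suc ?n) z)"
  let ?q = "cmod (f_plus a b ?n z)" and ?q' = "cmod (f_plus a b (Suc ?n) z)"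
  have "of_real (a ?n) * f_minus a b (Suc ?n) z = (z - b ?n) * f_minus a b ?n z - a n * f_minus a b n z"
    by (rule solves_Suc[OF solves_f_minus])
  then have "a ?n * ?p' = cmod ((z - b ?n) * f_minus a b ?n z - a n * f_minus a b n z)"
    using a_pos[of ?n] by (metis abs_of_pos norm_mult norm_of_real)
  also have "\<dots> \<le> cmod (z - b ?n) * ?p + a n * cmod (f_minus a b n z)"
    using norm_triangle_ineq4[of "(z - b ?n) * f_minus a b ?n z" "a n * f_minus a b n z"] a_pos[of n]
    by (simp add: norm_mult)
  also have "\<dots> \<le> (cmod z + M) * ?p + (M + 1) * ((M + 1) * ?p / Im z)"
  proof (intro add_mono mult_mono)
    show "cmod (z - b ?n) \<le> cmod z + M"
      using norm_triangle_ineq4[of z "b ?n"] b_bound[of ?n] by simp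
    show "cmod (f_minus a b n z) \<le> (M + 1) * ?p / Im z"
      using f_minus_le_Suc[OF assms, of n] assms by (simp add: field_simps)
  qed (use a_le a_pos[of n] M_pos in auto)
  finally have 1: "a ?n * ?p' \<le> (cmod z + M + (M + 1)\<^sup>2 / Im z) * ?p"
    by (simp add: power2_eq_square algebra_simps)
  have "a ?n * ?q' \<le> (M + 1) * ((M + 1) * ?q / Im z)"
    using f_plus_Suc_le[OF assms, of ?n] assms a_le[of ?n] a_pos[of ?n] M_pos
    by (intro mult_mono) (auto simp: field_simps)
  then have 2: "a ?n * ?q' \<le> (M + 1)\<^sup>2 / Im z * ?q" by (simp add: power2_eq_square algebra_simps)
  have "1 = cmod (of_real (a ?n) * (f_minus a b (Suc ?n) z * f_plus a b ?n z - f_minus a b ?n z * f_plus a b (Suc ?n) z))"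
    using wronskian_f[OF assms, of ?n] by simp
  also have "\<dots> \<le> a ?n * (?p' * ?q + ?p * ?q')"
    unfolding norm_mult norm_of_real using a_pos[of ?n]
    by (intro mult_mono order_trans[OF norm_triangle_ineq4]) (auto simp: norm_mult)
  also have "\<dots> = (a ?n * ?p') * ?q + ?p * (a ?n * ?q')" by (simp add: algebra_simps)
  also have "\<dots> \<le> (cmod z + M + (M + 1)\<^sup>2 / Im z) * ?p * ?q + ?p * ((M + 1)\<^sup>2 / Im z * ?q)"
    by (intro add_mono mult_right_mono mult_left_mono 1 2) auto
  finally show ?thesis by (simp add: norm_mult algebra_simps)
qed

text \<open>The real parts telescope. The sign \<open>s\<close> covers the conventions of \<open>w_-\<close> and \<open>w_+\<close> together.\<close>

lemma sum_ln_norm_ratio: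
  fixes f :: "nat \<Rightarrow> complex"
  assumes "\<And>n. n \<ge> 1 \<Longrightarrow> f n \<noteq> 0" and "s \<in> {1, -1}"
  shows "Re (\<Sum>n=1..N. Ln (s * (f (n + 1) / f n))) = ln (cmod (f (Suc N))) - ln (cmod (f 1))"
proof (induction N)
  case (Suc N)
  have "Re (Ln (s * (f (Suc N + 1) / f (Suc N)))) = ln (cmod (s * (f (Suc N + 1) / f (Suc N))))"
    using assms by (intro Re_Ln) auto
  also have "\<dots> = ln (cmod (f (Suc (Suc N)))) - ln (cmod (f (Suc N)))"
    using assms by (auto simp: norm_mult norm_divide ln_div)
  finally show ?case using Suc by simp
qed simp

lemma Re_w_plus:
  assumes "Im z > 0"
  shows "Re (w_plus a b N z) = (ln (cmod (f_plus a b (Suc N) z)) - ln (cmod (f_plus a b 1 z))) / N"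
  using sum_ln_norm_ratio[of "\<lambda>n. f_plus a b n z" "-1" N] f_plus_nonzero[OF assms]
  by (simp add: w_plus_def Re_divide_of_nat)

lemma Re_w_minus:
  assumes "Im z > 0"
  shows "Re (w_minus a b N z) = ln (cmod (f_minus a b (Suc N) z)) / N"
proof -
  have "f_minus a b n z \<noteq> 0" if "n \<ge> 1" for n
    using f_minus_nonzero[of z "n - 1"] that assms by simp
  then show ?thesis
    using sum_ln_norm_ratio[of "\<lambda>n. f_minus a b n z" 1 N] by (simp add: w_minus_def Re_divide_of_nat)
qed

lemma Re_w_sum_tendsto_0:
  assumes "Im z > 0"
  shows "(\<lambda>N. Re (w_plus a b N z) + Re (w_minus a b N z)) \<longlonglongrightarrow> 0"
proof -
  define P where "P N = cmod (f_minus a b (Suc N) z * f_plus a b (Suc N) z)" for N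
  define C where "C = cmod z + M + 2 * (M + 1)\<^sup>2 / Im z"
  have C: "C > 0" using assms M_pos by (simp add: C_def add_nonneg_pos)
  have P: "0 < P N" "P N \<le> 1 / Im z" "1 / C \<le> P N" for N
    using f_product_upper[OF assms, of N] f_product_lower[OF assms, of N, folded C_def P_def]
      f_minus_nonzero[of z N] f_plus_nonzero[OF assms, of "Suc N"] assms C
    by (auto simp: P_def field_simps)
  define B where "B = \<bar>ln (1 / C)\<bar> + \<bar>ln (1 / Im z)\<bar> + \<bar>ln (cmod (f_plus a b 1 z))\<bar>"
  have "\<bar>ln (P N) - ln (cmod (f_plus a b 1 z))\<bar> \<le> B" for N
  proof -
    have "ln (P N) \<le> ln (1 / Im z)" using P[of N] assms by (subst ln_le_cancel_iff) auto
    moreover have "ln (1 / C) \<le> ln (P N)" using P[of N] C by (subst ln_le_cancel_iff) auto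
    ultimately show ?thesis unfolding B_def by linarith
  qed
  then have "(\<lambda>N. (ln (P N) - ln (cmod (f_plus a b 1 z))) * (1 / real N)) \<longlonglongrightarrow> 0"
    by (intro lim_null_mult_left_bounded[where B = B] lim_1_over_n) auto
  moreover have "(ln (P N) - ln (cmod (f_plus a b 1 z))) * (1 / real N)
      = Re (w_plus a b N z) + Re (w_minus a b N z)" for N
    using f_minus_nonzero[of z N] f_plus_nonzero[OF assms, of "Suc N"] assms
    by (simp add: Re_w_plus[OF assms] Re_w_minus[OF assms] P_def norm_mult ln_mult
        add_divide_distrib diff_divide_distrib)
  ultimately show ?thesis by simp
qed

lemma Re_w_plus_limsup:
  assumes "Im z > 0" and "filterlim Ns at_top sequentially"
    and "(\<lambda>j. Re (w_plus a b (Ns j) z)) \<longlonglongrightarrow> l"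
  shows "l \<le> 0"
proof (rule tendsto_le[OF _ _ assms(3)])
  let ?c = "- ln (cmod (f_plus a b 1 z))"
  have "(\<lambda>N. ?c / real N) \<longlonglongrightarrow> 0" by (rule lim_const_over_n)
  then show "(\<lambda>j. ?c / real (Ns j)) \<longlonglongrightarrow> 0" by (rule filterlim_compose[OF _ assms(2)])
  have "\<forall>\<^sub>F n in sequentially. cmod (f_plus a b (Suc n) z) < 1"
    using order_tendstoD(2)[OF LIMSEQ_Suc[OF f_plus_tendsto_0[OF assms(1)]], of 1] by simp
  then have "\<forall>\<^sub>F n in sequentially. Re (w_plus a b n z) \<le> ?c / n"
  proof eventually_elim
    case (elim n)
    then have "ln (cmod (f_plus a b (Suc n) z)) \<le> 0" by (simp add: ln_le_zero_iff f_plus_nonzero[OF assms(1)])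
    then show ?case unfolding Re_w_plus[OF assms(1)] by (intro divide_right_mono) auto
  qed
  then show "\<forall>\<^sub>F j in sequentially. Re (w_plus a b (Ns j) z) \<le> ?c / real (Ns j)"
    using assms(2) by (rule eventually_compose_filterlim)
qed simp

text \<open>For \<open>\<bar>z\<bar> > 3 M + 2\<close> one has \<open>\<bar>z - b(n)\<bar> > 2 (M + 1)\<close>, twice the bound on the off-diagonal entries, so
  the solution grows. This confines the zeros of \<open>f_-\<close> to a fixed interval.\<close>

lemma f_minus_growth:
  assumes "cmod z > 3 * M + 2"
  shows "cmod (f_minus a b n z) \<le> cmod (f_minus a b (Suc n) z) \<and> f_minus a b (Suc n) z \<noteq> 0"
proof (induction n)
  case (Suc n)
  let ?f = "\<lambda>n. f_minus a b n z"
  have "(2 * M + 2) * cmod (?f (Suc n)) - (M + 1) * cmod (?f (Suc n))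
      \<le> cmod (z - b (Suc n)) * cmod (?f (Suc n)) - a n * cmod (?f n)"
  proof (intro diff_mono mult_mono)
    show "2 * M + 2 \<le> cmod (z - b (Suc n))"
      using norm_triangle_ineq2[of z "b (Suc n)"] b_bound[of "Suc n"] assms by simp
  qed (use Suc a_le a_pos[of n] M_pos in auto)
  also have "\<dots> \<le> cmod (of_real (a (Suc n)) * ?f (Suc (Suc n)))"
    unfolding solves_Suc[OF solves_f_minus]
    using norm_triangle_ineq2[of "(z - b (Suc n)) * ?f (Suc n)" "a n * ?f n"] a_pos[of n] by (simp add: norm_mult)
  also have "\<dots> \<le> (M + 1) * cmod (?f (Suc (Suc n)))"
    unfolding norm_mult using a_le[of "Suc n"] a_pos[of "Suc n"] by (intro mult_right_mono) auto
  finally have "(M + 1) * cmod (?f (Suc n)) \<le> (M + 1) * cmod (?f (Suc (Suc n)))"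
    by (simp add: algebra_simps)
  then have "cmod (?f (Suc n)) \<le> cmod (?f (Suc (Suc n)))" using M_pos by simp
  then show ?case using Suc by auto
qed simp

text \<open>Two consecutive polynomials are carried through the induction because the recurrence has order two.\<close>

lemma f_minus_polynomial:
  "\<exists>p q. degree p = n \<and> lead_coeff p = 1 \<and> (\<forall>z. poly p z = of_real (\<Prod>i=1..n. a i) * f_minus a b (Suc n) z) \<and>
     degree q = Suc n \<and> lead_coeff q = 1 \<and>
     (\<forall>z. poly q z = of_real (\<Prod>i=1..Suc n. a i) * f_minus a b (Suc (Suc n)) z)"
proof (induction n)
  case 0
  have "f_minus a b (Suc (Suc 0)) z * of_real (a 1) = z - of_real (b 1)" for z
    using solves_Suc[OF solves_f_minus, of 0 z] by (simp add: mult.commute)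
  then show ?case
    by (intro exI[of _ "[:1:]"] exI[of _ "[:- of_real (b 1), 1:]"]) (auto simp: mult.commute)
next
  case (Suc n)
  then obtain p q where p: "degree p = n" "\<And>z. poly p z = of_real (\<Prod>i=1..n. a i) * f_minus a b (Suc n) z"
    and q: "degree q = Suc n" "lead_coeff q = 1"
      "\<And>z. poly q z = of_real (\<Prod>i=1..Suc n. a i) * f_minus a b (Suc (Suc n)) z" by blast
  define l where "l = [:- of_real (b (Suc (Suc n))), 1 :: complex:]"
  define r where "r = l * q - Polynomial.smult (of_real (a (Suc n) ^ 2)) p"
  have q0: "q \<noteq> 0" using q by auto
  have lq: "degree (l * q) = Suc (Suc n)"
    using q q0 by (simp add: l_def degree_mult_eq del: mult_pCons_left)
  have lq': "lead_coeff (l * q) = 1"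
    unfolding lead_coeff_mult q(2) by (simp add: l_def)
  have "degree (Polynomial.smult (of_real (a (Suc n) ^ 2)) p) < degree (l * q)"
    using le_less_trans[OF degree_smult_le] p(1) lq by simp
  then have deg: "degree r = Suc (Suc n)"
    unfolding r_def diff_conv_add_uminus using lq by (subst degree_add_eq_left) auto
  moreover have "lead_coeff r = 1"
    using lq lq' p(1) unfolding deg by (simp add: r_def coeff_eq_0)
  moreover have "poly r z = of_real (\<Prod>i=1..Suc (Suc n). a i) * f_minus a b (Suc (Suc (Suc n))) z" for z
  proof -
    have "of_real (\<Prod>i=1..Suc (Suc n). a i) * f_minus a b (Suc (Suc (Suc n))) z
        = of_real (\<Prod>i=1..Suc n. a i) * (of_real (a (Suc (Suc n))) * f_minus a b (Suc (Suc (Suc n))) z)"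
      by simp
    also have "\<dots> = (z - of_real (b (Suc (Suc n)))) * poly q z - of_real (a (Suc n) ^ 2) * poly p z"
      unfolding solves_Suc[OF solves_f_minus] q(3) p(2) by (simp add: algebra_simps power2_eq_square)
    finally show ?thesis by (simp add: r_def l_def algebra_simps)
  qed
  ultimately show ?case using q by (intro exI[of _ q] exI[of _ r]) auto
qed

lemma f_minus_factorization:
  "\<exists>\<xi>. (\<forall>i<N. \<bar>\<xi> i\<bar> \<le> 3 * M + 2) \<and>
     (\<forall>z. of_real (\<Prod>i=1..N. a i) * f_minus a b (Suc N) z = (\<Prod>i<N. z - of_real (\<xi> i)))"
proof -
  obtain p where p: "degree p = N" "lead_coeff p = 1"
      "\<And>z. poly p z = of_real (\<Prod>i=1..N. a i) * f_minus a b (Suc N) z"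
    using f_minus_polynomial[of N] by blast
  have "p \<noteq> 0" using p(2) by auto
  then obtain X where X: "size X = N" "p = (\<Prod>x\<in>#X. [:-x, 1:])"
    using alg_closed_imp_factorization[of p] p by auto
  obtain xs where xs: "mset xs = X" using ex_mset by blast
  have len: "length xs = N" using X(1) xs by auto
  have prod: "poly p z = (\<Prod>i<N. z - xs ! i)" for z
  proof -
    have "poly p z = prod_list (map (\<lambda>x. z - x) xs)"
      unfolding X(2) xs[symmetric] by (induction xs) (simp_all add: algebra_simps)
    also have "\<dots> = (\<Prod>i<N. z - xs ! i)" by (simp add: prod.list_conv_set_nth len atLeast0LessThan)
    finally show ?thesis .
  qed
  have root: "Im (xs ! i) = 0 \<and> cmod (xs ! i) \<le> 3 * M + 2" if "i < N" for i
  proof -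
    have "poly p (xs ! i) = 0" using that by (auto simp: prod)
    moreover have "(\<Prod>i=1..N. a i) \<noteq> 0" using a_pos by (simp add: less_imp_neq[symmetric])
    ultimately have "f_minus a b (Suc N) (xs ! i) = 0" by (simp add: p(3))
    then show ?thesis using f_minus_nonzero f_minus_growth by (meson not_le)
  qed
  show ?thesis
  proof (intro exI[of _ "\<lambda>i. Re (xs ! i)"] conjI allI impI)
    fix i assume "i < N" then show "\<bar>Re (xs ! i)\<bar> \<le> 3 * M + 2"
      using root[of i] abs_Re_le_cmod[of "xs ! i"] by linarith
  next
    fix z
    have "(\<Prod>i<N. z - xs ! i) = (\<Prod>i<N. z - of_real (Re (xs ! i)))"
      using root by (intro prod.cong refl) (auto simp: complex_eq_iff)
    then show "of_real (\<Prod>i=1..N. a i) * f_minus a b (Suc N) z = (\<Prod>i<N. z - of_real (Re (xs ! i)))"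
      using p(3) prod by simp
  qed
qed

end

section \<open>The logarithmic energy\<close>

text \<open>For a kernel of the form \<open>\<integral> \<phi>(s,q) \<phi>(t,q) d\<rho>(q)\<close>, Tonelli's theorem turns the mutual energy of \<open>\<alpha>\<close>
  and \<open>\<beta>\<close> into an inner product of their transforms in \<open>L\<^sup>2(\<rho>)\<close>.\<close>

lemma mixed_energy_eq_integral:
  fixes \<phi> :: "'a \<Rightarrow> 'b \<Rightarrow> ennreal"
  assumes "sigma_finite_measure \<alpha>" "sigma_finite_measure \<beta>" "sigma_finite_measure \<rho>"
    and sets: "sets \<alpha> = sets S" "sets \<beta> = sets S"
    and \<phi>: "case_prod \<phi> \<in> borel_measurable (S \<Otimes>\<^sub>M \<rho>)"
  shows "(\<integral>\<^sup>+s. \<integral>\<^sup>+t. \<integral>\<^sup>+q. \<phi> s q * \<phi> t q \<partial>\<rho> \<partial>\<beta> \<partial>\<alpha>)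
       = (\<integral>\<^sup>+q. (\<integral>\<^sup>+s. \<phi> s q \<partial>\<alpha>) * (\<integral>\<^sup>+t. \<phi> t q \<partial>\<beta>) \<partial>\<rho>)"
proof -
  interpret A: sigma_finite_measure \<alpha> by fact
  interpret B: sigma_finite_measure \<beta> by fact
  interpret R: sigma_finite_measure \<rho> by fact
  interpret BR: pair_sigma_finite \<rho> \<beta> ..
  interpret AR: pair_sigma_finite \<rho> \<alpha> ..
  note sets[measurable_cong]
  have [measurable]: "case_prod \<phi> \<in> borel_measurable (\<alpha> \<Otimes>\<^sub>M \<rho>)" "case_prod \<phi> \<in> borel_measurable (\<beta> \<Otimes>\<^sub>M \<rho>)"
    using \<phi> by measurable
  have "(\<integral>\<^sup>+t. \<integral>\<^sup>+q. \<phi> s q * \<phi> t q \<partial>\<rho> \<partial>\<beta>) = (\<integral>\<^sup>+q. \<phi> s q * (\<integral>\<^sup>+t. \<phi> t q \<partial>\<beta>) \<partial>\<rho>)"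
    if [measurable]: "s \<in> space \<alpha>" for s
    by (subst BR.Fubini') (auto intro!: nn_integral_cong nn_integral_cmult)
  then have "(\<integral>\<^sup>+s. \<integral>\<^sup>+t. \<integral>\<^sup>+q. \<phi> s q * \<phi> t q \<partial>\<rho> \<partial>\<beta> \<partial>\<alpha>)
      = (\<integral>\<^sup>+s. \<integral>\<^sup>+q. \<phi> s q * (\<integral>\<^sup>+t. \<phi> t q \<partial>\<beta>) \<partial>\<rho> \<partial>\<alpha>)"
    by (intro nn_integral_cong)
  also have "\<dots> = (\<integral>\<^sup>+q. (\<integral>\<^sup>+s. \<phi> s q \<partial>\<alpha>) * (\<integral>\<^sup>+t. \<phi> t q \<partial>\<beta>) \<partial>\<rho>)"
    by (subst AR.Fubini') (auto intro!: nn_integral_cong nn_integral_multc)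
  finally show ?thesis .
qed

lemma mixed_energy_Cauchy_Schwarz:
  fixes \<phi> :: "'a \<Rightarrow> 'b \<Rightarrow> ennreal"
  assumes sf: "sigma_finite_measure \<alpha>" "sigma_finite_measure \<beta>" "sigma_finite_measure \<rho>"
    and sets: "sets \<alpha> = sets S" "sets \<beta> = sets S"
    and \<phi>: "case_prod \<phi> \<in> borel_measurable (S \<Otimes>\<^sub>M \<rho>)"
  shows "(\<integral>\<^sup>+s. \<integral>\<^sup>+t. \<integral>\<^sup>+q. \<phi> s q * \<phi> t q \<partial>\<rho> \<partial>\<beta> \<partial>\<alpha>)\<^sup>2
       \<le> (\<integral>\<^sup>+s. \<integral>\<^sup>+t. \<integral>\<^sup>+q. \<phi> s q * \<phi> t q \<partial>\<rho> \<partial>\<alpha> \<partial>\<alpha>)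
         * (\<integral>\<^sup>+s. \<integral>\<^sup>+t. \<integral>\<^sup>+q. \<phi> s q * \<phi> t q \<partial>\<rho> \<partial>\<beta> \<partial>\<beta>)"
proof -
  interpret A: sigma_finite_measure \<alpha> by fact
  interpret B: sigma_finite_measure \<beta> by fact
  interpret R: sigma_finite_measure \<rho> by fact
  note sets[measurable_cong]
  have [measurable]: "case_prod \<phi> \<in> borel_measurable (\<alpha> \<Otimes>\<^sub>M \<rho>)" "case_prod \<phi> \<in> borel_measurable (\<beta> \<Otimes>\<^sub>M \<rho>)"
    using \<phi> by measurable
  show ?thesis
    unfolding mixed_energy_eq_integral[OF sf(1,2,3) sets(1,2) \<phi>]
      mixed_energy_eq_integral[OF sf(1,1,3) sets(1,1) \<phi>] mixed_energy_eq_integral[OF sf(2,2,3) sets(2,2) \<phi>]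
      power2_eq_square[symmetric]
    by (rule Cauchy_Schwarz_nn_integral) measurable
qed

text \<open>The point \<open>(r, u)\<close> stands for the interval of length \<open>r\<close> centred at \<open>u\<close>. The weight \<open>1 / r\<close> is chosen so
  that the associated kernel has a logarithmic singularity.\<close>

definition window :: "real \<Rightarrow> real \<times> real \<Rightarrow> ennreal" where
  "window s = (\<lambda>(r, u). if 0 < r \<and> r \<le> 1 \<and> \<bar>u - s\<bar> < r / 2 then ennreal (1 / r) else 0)"

lemma measurable_window [measurable]: "case_prod window \<in> borel_measurable (borel \<Otimes>\<^sub>M (lborel \<Otimes>\<^sub>M lborel))"
  unfolding window_def by measurable

definition window_kernel :: "real \<Rightarrow> real \<Rightarrow> ennreal" where
  "window_kernel s t = (\<integral>\<^sup>+q. window s q * window t q \<partial>(lborel \<Otimes>\<^sub>M lborel))"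

text \<open>With \<open>d = \<bar>s - t\<bar>\<close>, the intervals of length \<open>r\<close> that contain both points have centres in a set of
  measure \<open>r - d\<close>, and \<open>\<integral>\<^sub>d\<^sup>1 (r - d) / r\<^sup>2 dr = d - ln d - 1\<close>.\<close>

lemma window_kernel_eq:
  assumes "s \<noteq> t" "\<bar>s - t\<bar> \<le> 1"
  shows "window_kernel s t = ennreal (\<bar>s - t\<bar> - ln \<bar>s - t\<bar> - 1)"
proof -
  define d where "d = \<bar>s - t\<bar>"
  have d: "0 < d" "d \<le> 1" using assms by (auto simp: d_def)
  have inner: "(\<integral>\<^sup>+u. window s (r, u) * window t (r, u) \<partial>lborel)
      = ennreal ((r - d) / r\<^sup>2) * indicator {d..1} r" for r
  proof (cases "0 < r \<and> r \<le> 1")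
    case True
    define l where "l = max s t - r / 2"
    define v where "v = min s t + r / 2"
    have "\<bar>u - s\<bar> < r / 2 \<and> \<bar>u - t\<bar> < r / 2 \<longleftrightarrow> u \<in> {l<..<v}" for u
      unfolding l_def v_def greaterThanLessThan_iff by linarith
    then have "window s (r, u) * window t (r, u) = ennreal (1 / r\<^sup>2) * indicator {l<..<v} u" for u
      using True by (auto simp: window_def indicator_def power2_eq_square simp flip: ennreal_mult)
    then have "(\<integral>\<^sup>+u. window s (r, u) * window t (r, u) \<partial>lborel) = (\<integral>\<^sup>+u. ennreal (1 / r\<^sup>2) * indicator {l<..<v} u \<partial>lborel)"
      by simp
    also have "\<dots> = ennreal (1 / r\<^sup>2) * emeasure lborel {l<..<v}" by (simp add: nn_integral_cmult)
    also have "\<dots> = ennreal ((r - d) / r\<^sup>2) * indicator {d..1} r"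
    proof (cases "d \<le> r")
      case True
      have "v - l = r - d" "l \<le> v" using True by (auto simp: l_def v_def d_def max_def min_def)
      then show ?thesis using True \<open>0 < r \<and> r \<le> 1\<close> by (simp add: ennreal_mult[symmetric])
    next
      case False
      then have "v \<le> l" by (auto simp: l_def v_def d_def max_def min_def)
      then show ?thesis using False by (simp add: greaterThanLessThan_empty_iff2)
    qed
    finally show ?thesis .
  next
    case False
    then show ?thesis using d by (auto simp: window_def)
  qed
  have "window_kernel s t = (\<integral>\<^sup>+r. \<integral>\<^sup>+u. window s (r, u) * window t (r, u) \<partial>lborel \<partial>lborel)"
    unfolding window_kernel_def by (rule lborel.nn_integral_fst[symmetric]) measurable
  also have "\<dots> = (\<integral>\<^sup>+r. ennreal ((r - d) / r\<^sup>2) * indicator {d..1} r \<partial>lborel)" by (simp add: inner)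
  also have "\<dots> = ennreal ((ln 1 + d / 1) - (ln d + d / d))"
  proof (rule nn_integral_FTC_Icc)
    fix r assume r: "r \<in> {d..1}"
    then have "r > 0" using d by auto
    then show "((\<lambda>r. ln r + d / r) has_real_derivative (r - d) / r\<^sup>2) (at r)"
      by (auto intro!: derivative_eq_intros simp: field_simps power2_eq_square)
    show "0 \<le> (r - d) / r\<^sup>2" using r by auto
  qed (use d in auto)
  finally show ?thesis using d by (simp add: d_def algebra_simps)
qed

text \<open>The negative part that occurs in the definition of the logarithmic energy; it is infinite on the
  diagonal.\<close>

definition log_kernel :: "real \<Rightarrow> real \<Rightarrow> ennreal" where
  "log_kernel s t = e2ennreal (- ln_ext \<bar>s - t\<bar>)"

lemma log_kernel_eq: "s \<noteq> t \<Longrightarrow> log_kernel s t = ennreal (- ln \<bar>s - t\<bar>)"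
  by (simp add: log_kernel_def ln_ext_def e2ennreal_ereal)

lemma log_kernel_diag: "log_kernel s s = \<infinity>"
  by (simp add: log_kernel_def ln_ext_def)

lemma measurable_log_kernel [measurable]: "case_prod log_kernel \<in> borel_measurable (borel \<Otimes>\<^sub>M borel)"
proof -
  have "case_prod log_kernel = (\<lambda>(s, t). if s = t then \<infinity> else ennreal (- ln \<bar>s - t\<bar>))"
    by (auto simp: log_kernel_eq log_kernel_diag)
  then show ?thesis by simp
qed

lemma window_kernel_le_log_kernel:
  assumes "\<bar>s - t\<bar> \<le> 1"
  shows "window_kernel s t \<le> log_kernel s t"
proof (cases "s = t")
  case False
  then show ?thesis using assms by (simp add: window_kernel_eq log_kernel_eq ennreal_leI)
qed (simp add: log_kernel_diag)

lemma log_kernel_le_window_kernel: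
  assumes "s \<noteq> t" "\<bar>s - t\<bar> \<le> 1"
  shows "log_kernel s t \<le> 1 + window_kernel s t"
proof -
  have "0 \<le> \<bar>s - t\<bar> - ln \<bar>s - t\<bar> - 1"
    using ln_le_minus_one[of "\<bar>s - t\<bar>"] assms by simp
  then have "1 + window_kernel s t = ennreal (1 + (\<bar>s - t\<bar> - ln \<bar>s - t\<bar> - 1))"
    unfolding window_kernel_eq[OF assms] by (subst ennreal_plus) auto
  then show ?thesis using assms by (simp add: log_kernel_eq ennreal_leI)
qed

text \<open>If the potential of \<open>\<tau>\<close> is at least \<open>c\<close> on the carrier of \<open>\<mu>\<close>, so is the mutual energy of \<open>\<mu>\<close> and
  \<open>\<tau>\<close>; if it is at most \<open>C\<close> on \<open>I\<close>, the self-energy of \<open>\<tau>\<close> is at most \<open>C m\<close>. Cauchy-Schwarz then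
  bounds the energy of \<open>\<mu>\<close> from below. Passing to the positive definite window kernel costs at
  most the mass \<open>m\<close> in the mutual energy and only decreases the two self-energies.\<close>

lemma energy_lower_bound:
  fixes \<mu> \<tau> :: "real measure"
  assumes \<mu>: "real_distribution \<mu>" and \<tau>: "finite_measure \<tau>" "sets \<tau> = sets borel"
    and diam: "\<And>s t. s \<in> I \<Longrightarrow> t \<in> I \<Longrightarrow> \<bar>s - t\<bar> \<le> 1"
    and \<mu>I: "AE s in \<mu>. s \<in> I" and \<tau>I: "AE t in \<tau>. t \<in> I"
    and upper: "\<And>s. s \<in> I \<Longrightarrow> (\<integral>\<^sup>+t. log_kernel s t \<partial>\<tau>) \<le> ennreal C"
    and lower: "AE s in \<mu>. ennreal c \<le> (\<integral>\<^sup>+t. log_kernel s t \<partial>\<tau>)"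
    and m: "emeasure \<tau> (space \<tau>) = ennreal m" "0 \<le> m" "m \<le> c / 2"
  shows "ennreal ((c / 2)\<^sup>2) \<le> (\<integral>\<^sup>+s. \<integral>\<^sup>+t. log_kernel s t \<partial>\<mu> \<partial>\<mu>) * (ennreal C * ennreal m)"
proof -
  interpret M: real_distribution \<mu> by fact
  interpret T: finite_measure \<tau> by fact
  note \<tau>(2)[measurable_cong]
  have [measurable]: "case_prod window \<in> borel_measurable (borel \<Otimes>\<^sub>M (lborel \<Otimes>\<^sub>M lborel))" by measurable
  have plane: "sigma_finite_measure (lborel \<Otimes>\<^sub>M lborel :: (real \<times> real) measure)"
    unfolding lborel_prod by (rule lborel.sigma_finite_measure_axioms)
  have Ksec: "ennreal (c / 2) \<le> (\<integral>\<^sup>+t. window_kernel s t \<partial>\<tau>)"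
    if s: "s \<in> I" and c: "ennreal c \<le> (\<integral>\<^sup>+t. log_kernel s t \<partial>\<tau>)" for s
  proof -
    have "(\<integral>\<^sup>+t. log_kernel s t \<partial>\<tau>) \<noteq> \<infinity>" using upper[OF s] by (auto simp: top_unique)
    \<comment> \<open>Finiteness of the potential of \<open>\<tau>\<close> at \<open>s\<close> rules out an atom of \<open>\<tau>\<close> there.\<close>
    then have "AE t in \<tau>. log_kernel s t \<noteq> \<infinity>" by (intro nn_integral_PInf_AE) measurable
    then have "AE t in \<tau>. log_kernel s t \<le> 1 + window_kernel s t"
      using \<tau>I
    proof eventually_elim
      case (elim t)
      then show ?case using s diam log_kernel_diag by (intro log_kernel_le_window_kernel) auto
    qed
    then have "(\<integral>\<^sup>+t. log_kernel s t \<partial>\<tau>) \<le> (\<integral>\<^sup>+t. 1 + window_kernel s t \<partial>\<tau>)"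
      by (rule nn_integral_mono_AE)
    also have "\<dots> = ennreal m + (\<integral>\<^sup>+t. window_kernel s t \<partial>\<tau>)"
      using m(1) unfolding window_kernel_def by (subst nn_integral_add) auto
    finally have "ennreal c \<le> ennreal m + (\<integral>\<^sup>+t. window_kernel s t \<partial>\<tau>)" using c by simp
    then have "ennreal c - ennreal m \<le> (\<integral>\<^sup>+t. window_kernel s t \<partial>\<tau>)"
      by (simp add: ennreal_minus_le_iff)
    moreover have "ennreal (c / 2) \<le> ennreal c - ennreal m"
      using m by (subst ennreal_minus) (auto intro!: ennreal_leI)
    ultimately show ?thesis by simp
  qed
  have "ennreal (c / 2) = (\<integral>\<^sup>+s. ennreal (c / 2) \<partial>\<mu>)" using M.emeasure_space_1 by simp
  also have "\<dots> \<le> (\<integral>\<^sup>+s. \<integral>\<^sup>+t. window_kernel s t \<partial>\<tau> \<partial>\<mu>)"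
    by (rule nn_integral_mono_AE, use \<mu>I lower in eventually_elim) (rule Ksec)
  finally have "ennreal (c / 2) ^ 2 \<le> (\<integral>\<^sup>+s. \<integral>\<^sup>+t. window_kernel s t \<partial>\<tau> \<partial>\<mu>)\<^sup>2"
    by (rule power_mono) simp
  then have "ennreal ((c / 2)\<^sup>2) \<le> (\<integral>\<^sup>+s. \<integral>\<^sup>+t. window_kernel s t \<partial>\<tau> \<partial>\<mu>)\<^sup>2"
    using m by (simp add: ennreal_power)
  also have "\<dots> \<le> (\<integral>\<^sup>+s. \<integral>\<^sup>+t. window_kernel s t \<partial>\<mu> \<partial>\<mu>) * (\<integral>\<^sup>+s. \<integral>\<^sup>+t. window_kernel s t \<partial>\<tau> \<partial>\<tau>)"
    unfolding window_kernel_def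
    by (rule mixed_energy_Cauchy_Schwarz[where S = borel])
       (auto simp: \<tau> M.sigma_finite_measure_axioms T.sigma_finite_measure_axioms plane)
  also have "\<dots> \<le> (\<integral>\<^sup>+s. \<integral>\<^sup>+t. log_kernel s t \<partial>\<mu> \<partial>\<mu>) * (ennreal C * ennreal m)"
  proof (rule mult_mono)
    show "(\<integral>\<^sup>+s. \<integral>\<^sup>+t. window_kernel s t \<partial>\<mu> \<partial>\<mu>) \<le> (\<integral>\<^sup>+s. \<integral>\<^sup>+t. log_kernel s t \<partial>\<mu> \<partial>\<mu>)"
    proof (rule nn_integral_mono_AE, use \<mu>I in eventually_elim)
      fix s assume "s \<in> I"
      show "(\<integral>\<^sup>+t. window_kernel s t \<partial>\<mu>) \<le> (\<integral>\<^sup>+t. log_kernel s t \<partial>\<mu>)"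
        by (rule nn_integral_mono_AE, use \<mu>I in eventually_elim)
           (use \<open>s \<in> I\<close> diam in \<open>auto intro: window_kernel_le_log_kernel\<close>)
    qed
    have "(\<integral>\<^sup>+s. \<integral>\<^sup>+t. window_kernel s t \<partial>\<tau> \<partial>\<tau>) \<le> (\<integral>\<^sup>+s. ennreal C \<partial>\<tau>)"
    proof (rule nn_integral_mono_AE, use \<tau>I in eventually_elim)
      fix s assume "s \<in> I"
      have "(\<integral>\<^sup>+t. window_kernel s t \<partial>\<tau>) \<le> (\<integral>\<^sup>+t. log_kernel s t \<partial>\<tau>)"
        by (rule nn_integral_mono_AE, use \<tau>I in eventually_elim)
           (use \<open>s \<in> I\<close> diam in \<open>auto intro: window_kernel_le_log_kernel\<close>)
      also have "\<dots> \<le> ennreal C" using \<open>s \<in> I\<close> by (rule upper)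
      finally show "(\<integral>\<^sup>+t. window_kernel s t \<partial>\<tau>) \<le> ennreal C" .
    qed
    then show "(\<integral>\<^sup>+s. \<integral>\<^sup>+t. window_kernel s t \<partial>\<tau> \<partial>\<tau>) \<le> ennreal C * ennreal m"
      using m(1) by simp
  qed auto
  finally show ?thesis .
qed

lemma exp_log_energy_le:
  assumes \<mu>: "real_distribution \<mu>"
    and diam: "\<And>s t. s \<in> I \<Longrightarrow> t \<in> I \<Longrightarrow> \<bar>s - t\<bar> \<le> 1" and \<mu>I: "AE s in \<mu>. s \<in> I"
    and q: "0 \<le> q" "ennreal q \<le> (\<integral>\<^sup>+s. \<integral>\<^sup>+t. log_kernel s t \<partial>\<mu> \<partial>\<mu>)"
  shows "exp_ext (log_energy \<mu>) \<le> ennreal (exp (- q))"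
proof -
  interpret M: real_distribution \<mu> by fact
  have zero: "e2ennreal (ln_ext \<bar>s - t\<bar>) = 0" if "s \<in> I" "t \<in> I" for s t
    using diam[OF that] by (auto simp: ln_ext_def e2ennreal_ereal ennreal_neg e2ennreal_neg)
  have "(\<integral>\<^sup>+s. \<integral>\<^sup>+t. e2ennreal (ln_ext \<bar>s - t\<bar>) \<partial>\<mu> \<partial>\<mu>) = (\<integral>\<^sup>+s. 0 \<partial>\<mu>)"
  proof (rule nn_integral_cong_AE, use \<mu>I in eventually_elim)
    fix s assume "s \<in> I"
    have "(\<integral>\<^sup>+t. e2ennreal (ln_ext \<bar>s - t\<bar>) \<partial>\<mu>) = (\<integral>\<^sup>+t. 0 \<partial>\<mu>)"
      by (rule nn_integral_cong_AE, use \<mu>I in eventually_elim) (use zero \<open>s \<in> I\<close> in auto)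
    then show "(\<integral>\<^sup>+t. e2ennreal (ln_ext \<bar>s - t\<bar>) \<partial>\<mu>) = 0" by simp
  qed
  then have E: "log_energy \<mu> = - enn2ereal (\<integral>\<^sup>+s. \<integral>\<^sup>+t. log_kernel s t \<partial>\<mu> \<partial>\<mu>)"
    by (simp add: log_energy_def log_kernel_def minus_ereal_def zero_ennreal.rep_eq)
  have "ereal q \<le> enn2ereal (\<integral>\<^sup>+s. \<integral>\<^sup>+t. log_kernel s t \<partial>\<mu> \<partial>\<mu>)"
    using q by (simp add: less_eq_ennreal.rep_eq)
  then have "log_energy \<mu> \<le> - ereal q" unfolding E by (subst ereal_minus_le_minus)
  then show ?thesis by (cases "log_energy \<mu>") (auto simp: exp_ext_def)
qed

section \<open>Deviations of a logarithmic potential that is bounded below\<close>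

lemma abs_ln_ratio_le:
  fixes r \<delta> :: real
  assumes "1 - \<delta> \<le> r" "r \<le> 1 + \<delta>" "0 \<le> \<delta>" "\<delta> \<le> 1 / 2"
  shows "\<bar>ln r\<bar> \<le> 2 * \<delta>"
proof -
  have r: "r > 0" using assms by linarith
  have "ln r \<le> \<delta>" using ln_le_minus_one[OF r] assms by linarith
  moreover have "- (2 * \<delta>) \<le> ln r"
  proof -
    have "- ln r = ln (1 / r)" using r by (simp add: ln_div)
    also have "\<dots> \<le> 1 / r - 1" using r by (intro ln_le_minus_one) simp
    also have "\<dots> = (1 - r) / r" using r by (simp add: field_simps)
    also have "\<dots> \<le> \<delta> / (1 / 2)" using assms r by (intro frac_le) auto
    finally show ?thesis by simp
  qed
  ultimately show ?thesis using assms by linarith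
qed

text \<open>Dominated convergence for a parameter that tends to \<open>a\<close> from the right.\<close>

lemma tendsto_integral_at_right:
  fixes f :: "real \<Rightarrow> 'a \<Rightarrow> real"
  assumes "a < b"
    and [measurable]: "g \<in> borel_measurable M" "\<And>s. f s \<in> borel_measurable M"
    and w: "integrable M w"
    and lim: "AE t in M. ((\<lambda>s. f s t) \<longlongrightarrow> g t) (at_right a)"
    and bound: "\<And>s. a < s \<Longrightarrow> s < b \<Longrightarrow> AE t in M. \<bar>f s t\<bar> \<le> w t"
  shows "((\<lambda>s. \<integral>t. f s t \<partial>M) \<longlongrightarrow> (\<integral>t. g t \<partial>M)) (at_right a)"
proof (rule tendsto_at_right_sequentially[OF assms(1)])
  fix S :: "nat \<Rightarrow> real" assume S: "\<And>n. a < S n" "\<And>n. S n < b" "decseq S" "S \<longlonglongrightarrow> a"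
  have S': "filterlim S (at_right a) sequentially"
    using S(1,4) by (simp add: filterlim_at less_imp_neq[OF S(1), symmetric])
  show "(\<lambda>n. \<integral>t. f (S n) t \<partial>M) \<longlonglongrightarrow> (\<integral>t. g t \<partial>M)"
  proof (rule integral_dominated_convergence[where w = w])
    show "AE t in M. (\<lambda>n. f (S n) t) \<longlonglongrightarrow> g t"
      using lim by eventually_elim (rule filterlim_compose[OF _ S'])
    show "AE t in M. norm (f (S n) t) \<le> w t" for n
      using bound[OF S(1,2)] by simp
  qed (use w in auto)
qed

text \<open>A compactly supported probability measure whose logarithmic potential is bounded below by \<open>l\<close> on
  the real line. As \<open>ln 0 = 0\<close> here, integrability of \<open>ln \<bar>y - t\<bar>\<close> does not exclude an atom at \<open>y\<close>, which
  makes \<open>no_atom\<close> a separate assumption.\<close>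

locale log_potential = real_distribution \<kappa> for \<kappa> :: "real measure" +
  fixes R l :: real
  assumes support: "AE t in \<kappa>. \<bar>t\<bar> \<le> R"
    and no_atom: "\<And>y. AE t in \<kappa>. t \<noteq> y"
    and integrable_ln: "\<And>y. integrable \<kappa> (\<lambda>t. ln \<bar>y - t\<bar>)"
    and potential_ge: "\<And>y. l \<le> (\<integral>t. ln \<bar>y - t\<bar> \<partial>\<kappa>)"
begin

definition potential :: "real \<Rightarrow> real" where
  "potential y = (\<integral>t. ln \<bar>y - t\<bar> \<partial>\<kappa>)"

definition near :: "real \<Rightarrow> real \<Rightarrow> real \<Rightarrow> real" where
  "near x \<delta> y = (\<integral>t. ln \<bar>y - t\<bar> * indicator {x - \<delta><..<x + \<delta>} t \<partial>\<kappa>)"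

definition far :: "real \<Rightarrow> real \<Rightarrow> real \<Rightarrow> real" where
  "far x \<delta> y = (\<integral>t. ln \<bar>y - t\<bar> * indicator (- {x - \<delta><..<x + \<delta>}) t \<partial>\<kappa>)"

lemma integrable_ln_indicator: "B \<in> sets borel \<Longrightarrow> integrable \<kappa> (\<lambda>t. ln \<bar>y - t\<bar> * indicator B t)"
  by (rule integrable_real_mult_indicator[OF _ integrable_ln]) simp

lemma potential_split: "potential y = near x \<delta> y + far x \<delta> y"
proof -
  have "near x \<delta> y + far x \<delta> y =
      (\<integral>t. ln \<bar>y - t\<bar> * indicator {x - \<delta><..<x + \<delta>} t + ln \<bar>y - t\<bar> * indicator (- {x - \<delta><..<x + \<delta>}) t \<partial>\<kappa>)"
    unfolding near_def far_def by (rule Bochner_Integration.integral_add[symmetric]) (rule integrable_ln_indicator, simp)+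
  also have "\<dots> = potential y"
    unfolding potential_def by (rule Bochner_Integration.integral_cong) (auto simp: indicator_def)
  finally show ?thesis ..
qed

lemma near_nonpos:
  assumes "\<bar>y - x\<bar> \<le> \<delta>" "\<delta> \<le> 1 / 2"
  shows "near x \<delta> y \<le> 0"
proof -
  have "near x \<delta> y \<le> (\<integral>t. 0 \<partial>\<kappa>)"
    unfolding near_def
  proof (rule integral_mono_AE[OF integrable_ln_indicator])
    show "AE t in \<kappa>. ln \<bar>y - t\<bar> * indicator {x - \<delta><..<x + \<delta>} t \<le> 0"
      using no_atom[of y] by eventually_elim (use assms in \<open>auto simp: indicator_def\<close>)
  qed auto
  then show ?thesis by simp
qed

lemma near_tendsto_0: "((\<lambda>\<delta>. near x \<delta> x) \<longlongrightarrow> 0) (at_right 0)"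
proof -
  have "((\<lambda>\<delta>. near x \<delta> x) \<longlongrightarrow> (\<integral>t. 0 \<partial>\<kappa>)) (at_right 0)"
    unfolding near_def
  proof (rule tendsto_integral_at_right[where b = 1 and w = "\<lambda>t. \<bar>ln \<bar>x - t\<bar>\<bar>"])
    show "integrable \<kappa> (\<lambda>t. \<bar>ln \<bar>x - t\<bar>\<bar>)" using integrable_ln by simp
    show "AE t in \<kappa>. ((\<lambda>\<delta>. ln \<bar>x - t\<bar> * indicator {x - \<delta><..<x + \<delta>} t) \<longlongrightarrow> 0) (at_right 0)"
      using no_atom[of x]
    proof eventually_elim
      case (elim t)
      then have "\<forall>\<^sub>F \<delta> in at_right 0. \<delta> < \<bar>x - t\<bar>"
        by (intro eventually_at_right_less[THEN eventually_mono] order_tendstoD(2)[OF tendsto_ident_at]) simp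
      then have "\<forall>\<^sub>F \<delta> in at_right 0. ln \<bar>x - t\<bar> * indicator {x - \<delta><..<x + \<delta>} t = 0"
        by eventually_elim (auto simp: indicator_def)
      then show ?case by (rule tendsto_eventually)
    qed
    show "AE t in \<kappa>. \<bar>ln \<bar>x - t\<bar> * indicator {x - \<delta><..<x + \<delta>} t\<bar> \<le> \<bar>ln \<bar>x - t\<bar>\<bar>" for \<delta>
      by (auto simp: indicator_def)
  qed auto
  then show ?thesis by simp
qed

text \<open>For \<open>\<bar>x - t\<bar> \<ge> \<delta>\<close> and \<open>\<bar>y - x\<bar> < \<delta>\<^sup>2\<close> the ratio \<open>\<bar>y - t\<bar> / \<bar>x - t\<bar>\<close> differs from 1 by at most \<open>\<delta>\<close>.
  This is the reason for the choice \<open>h = \<delta>\<^sup>2\<close>.\<close>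

lemma far_diff_le:
  assumes "\<bar>y - x\<bar> < \<delta>\<^sup>2" "0 < \<delta>" "\<delta> \<le> 1 / 2"
  shows "\<bar>far x \<delta> y - far x \<delta> x\<bar> \<le> 2 * \<delta>"
proof -
  let ?B = "- {x - \<delta><..<x + \<delta>}"
  let ?d = "\<lambda>t. ln \<bar>y - t\<bar> * indicator ?B t - ln \<bar>x - t\<bar> * indicator ?B t"
  have int: "integrable \<kappa> ?d" by (intro Bochner_Integration.integrable_diff integrable_ln_indicator) auto
  have "far x \<delta> y - far x \<delta> x = (\<integral>t. ?d t \<partial>\<kappa>)"
    unfolding far_def by (rule Bochner_Integration.integral_diff[symmetric]) (rule integrable_ln_indicator, simp)+
  moreover have "\<bar>\<integral>t. ?d t \<partial>\<kappa>\<bar> \<le> (\<integral>t. \<bar>?d t\<bar> \<partial>\<kappa>)" by (rule integral_abs_bound)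
  moreover have "(\<integral>t. \<bar>?d t\<bar> \<partial>\<kappa>) \<le> (\<integral>t. 2 * \<delta> \<partial>\<kappa>)"
  proof (rule integral_mono)
    fix t
    show "\<bar>?d t\<bar> \<le> 2 * \<delta>"
    proof (cases "t \<in> ?B")
      case True
      have D: "\<delta> \<le> \<bar>x - t\<bar>" using True by (auto simp: abs_if split: if_splits)
      have "\<bar>y - x\<bar> \<le> \<delta> * \<bar>x - t\<bar>"
        using assms(1,2) mult_left_mono[OF D, of \<delta>] unfolding power2_eq_square by linarith
      then have "\<bar>y - t\<bar> \<le> (1 + \<delta>) * \<bar>x - t\<bar>" "(1 - \<delta>) * \<bar>x - t\<bar> \<le> \<bar>y - t\<bar>"
        by (simp_all add: algebra_simps)
      then have r: "\<bar>y - t\<bar> / \<bar>x - t\<bar> \<le> 1 + \<delta>" "1 - \<delta> \<le> \<bar>y - t\<bar> / \<bar>x - t\<bar>"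
        using D assms by (simp_all add: pos_divide_le_eq pos_le_divide_eq)
      have "0 < (1 - \<delta>) * \<bar>x - t\<bar>" using D assms by (intro mult_pos_pos) auto
      then have "\<bar>y - t\<bar> > 0" using \<open>(1 - \<delta>) * \<bar>x - t\<bar> \<le> \<bar>y - t\<bar>\<close> by linarith
      then have "?d t = ln (\<bar>y - t\<bar> / \<bar>x - t\<bar>)"
        using True D assms by (subst ln_divide_pos) auto
      then show ?thesis using abs_ln_ratio_le[OF r(2,1)] assms by simp
    qed (use assms in simp)
  qed (use int in auto)
  moreover have "(\<integral>t. 2 * \<delta> \<partial>\<kappa>) = 2 * \<delta>" using prob_space by simp
  ultimately show ?thesis by linarith
qed

text \<open>The lower bound on the whole potential passes to its near part, because the far part is bounded
  above by the size of the support.\<close>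

lemma near_ge:
  assumes "\<bar>y - x\<bar> < \<delta>" "\<delta> \<le> 1"
  shows "l - ln (\<bar>R\<bar> + \<bar>x\<bar> + 1) \<le> near x \<delta> y"
proof -
  let ?D = "\<bar>R\<bar> + \<bar>x\<bar> + 1"
  have "far x \<delta> y \<le> (\<integral>t. ln ?D \<partial>\<kappa>)"
    unfolding far_def
  proof (rule integral_mono_AE[OF integrable_ln_indicator])
    show "AE t in \<kappa>. ln \<bar>y - t\<bar> * indicator (- {x - \<delta><..<x + \<delta>}) t \<le> ln ?D"
      using support no_atom[of y]
    proof eventually_elim
      case (elim t)
      then have "ln \<bar>y - t\<bar> \<le> ln ?D" using assms by (subst ln_le_cancel_iff) auto
      then show ?case by (auto simp: indicator_def)
    qed
  qed auto
  then have "far x \<delta> y \<le> ln ?D" using prob_space by simp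
  then show ?thesis using potential_split[of y x \<delta>] potential_ge[of y] by (simp add: potential_def)
qed

text \<open>On the interval \<open>- ln \<bar>x - t\<bar>\<close> is at least \<open>ln (1/\<delta>)\<close>. Together with \<open>near_tendsto_0\<close> this makes the mass
  of the interval \<open>o(1 / ln (1/\<delta>))\<close>, the decisive quantitative gain.\<close>

lemma near_mass_le:
  assumes "0 < \<delta>" "\<delta> \<le> 1"
  shows "measure \<kappa> {x - \<delta><..<x + \<delta>} * ln (1 / \<delta>) \<le> - near x \<delta> x"
proof -
  have "near x \<delta> x \<le> (\<integral>t. - ln (1 / \<delta>) * indicator {x - \<delta><..<x + \<delta>} t \<partial>\<kappa>)"
    unfolding near_def
  proof (rule integral_mono_AE[OF integrable_ln_indicator])
    show "AE t in \<kappa>. ln \<bar>x - t\<bar> * indicator {x - \<delta><..<x + \<delta>} t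
        \<le> - ln (1 / \<delta>) * indicator {x - \<delta><..<x + \<delta>} t"
      using no_atom[of x]
    proof eventually_elim
      case (elim t)
      then have "ln \<bar>x - t\<bar> \<le> - ln (1 / \<delta>)" if "t \<in> {x - \<delta><..<x + \<delta>}"
      proof -
        have "\<bar>x - t\<bar> \<le> \<delta>" using that by (simp add: abs_le_iff)
        then show ?thesis using elim assms by (simp add: ln_div)
      qed
      then show ?case by (auto simp: indicator_def)
    qed
  qed (simp_all add: integrable_real_indicator emeasure_eq_measure)
  also have "\<dots> = - ln (1 / \<delta>) * measure \<kappa> {x - \<delta><..<x + \<delta>}" by simp
  finally show ?thesis by (simp add: mult.commute)
qed

lemma nn_integral_log_kernel_near:
  assumes "\<bar>y - x\<bar> < \<delta>" "\<delta> \<le> 1 / 2"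
  shows "(\<integral>\<^sup>+t. log_kernel y t \<partial>density \<kappa> (indicator {x - \<delta><..<x + \<delta>})) = ennreal (- near x \<delta> y)"
proof -
  let ?I = "{x - \<delta><..<x + \<delta>}"
  have "(\<integral>\<^sup>+t. log_kernel y t \<partial>density \<kappa> (indicator ?I)) = (\<integral>\<^sup>+t. indicator ?I t * log_kernel y t \<partial>\<kappa>)"
    by (rule nn_integral_density) measurable
  also have "\<dots> = (\<integral>\<^sup>+t. ennreal (- (ln \<bar>y - t\<bar> * indicator ?I t)) \<partial>\<kappa>)"
    by (rule nn_integral_cong_AE, use no_atom[of y] in eventually_elim)
       (auto simp: indicator_def log_kernel_eq)
  also have "\<dots> = ennreal (\<integral>t. - (ln \<bar>y - t\<bar> * indicator ?I t) \<partial>\<kappa>)"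
  proof (rule nn_integral_eq_integral)
    show "integrable \<kappa> (\<lambda>t. - (ln \<bar>y - t\<bar> * indicator ?I t))"
      by (intro Bochner_Integration.integrable_minus integrable_ln_indicator) simp
    show "AE t in \<kappa>. 0 \<le> - (ln \<bar>y - t\<bar> * indicator ?I t)"
      using no_atom[of y] by eventually_elim (use assms in \<open>auto simp: indicator_def\<close>)
  qed
  finally show ?thesis by (simp add: near_def)
qed

text \<open>Near \<open>x\<close> the potential cannot rise by \<open>\<epsilon>\<close>: the near part at \<open>y\<close> is nonpositive and the near part at \<open>x\<close>
  is small. A deviation is therefore a drop by \<open>\<epsilon>\<close>, and the near part has to account for it.\<close>

lemma deviation_near_le:
  assumes y: "y \<in> deviation_set x \<epsilon> potential" "\<bar>y - x\<bar> < \<delta>\<^sup>2"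
    and \<delta>: "0 < \<delta>" "\<delta> \<le> 1 / 2" "2 * \<delta> \<le> \<epsilon> / 2" and small: "- near x \<delta> x < \<epsilon> / 2"
  shows "near x \<delta> y \<le> - (\<epsilon> / 2)"
proof -
  have "\<delta>\<^sup>2 \<le> \<delta> * 1" using \<delta> unfolding power2_eq_square by (intro mult_left_mono) auto
  then have "near x \<delta> y \<le> 0" using near_nonpos[of y x \<delta>] y \<delta> by linarith
  moreover have "near x \<delta> x \<le> 0" using near_nonpos[of x x \<delta>] \<delta> by simp
  moreover have "\<bar>far x \<delta> y - far x \<delta> x\<bar> \<le> 2 * \<delta>" using far_diff_le y \<delta> by blast
  moreover have "\<bar>potential y - potential x\<bar> \<ge> \<epsilon>" using y by (simp add: deviation_set_def)
  ultimately show ?thesis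
    using small \<delta> unfolding potential_split[of _ x \<delta>] by linarith
qed

text \<open>By \<open>energy_lower_bound\<close> with \<open>c = \<epsilon>/2\<close>, every admissible \<open>\<mu>\<close> has energy at least \<open>(\<epsilon>/4)\<^sup>2 / (C m)\<close>. The
  threshold \<open>\<eta>\<close> is chosen so that \<open>m ln (1/\<delta>) < \<eta>\<close> makes this at least \<open>2 (N + 1) ln (1/\<delta>)\<close>.\<close>

lemma deviation_capacity_small:
  assumes "\<epsilon> > 0"
  shows "\<forall>\<^sub>F h in at_right 0.
    log_cap (deviation_set x \<epsilon> potential \<inter> {x - h<..<x + h}) \<le> ennreal (h ^ Suc N)"
proof -
  define C where "C = \<bar>l\<bar> + ln (\<bar>R\<bar> + \<bar>x\<bar> + 1) + 1"
  have C: "C > 0" "- (l - ln (\<bar>R\<bar> + \<bar>x\<bar> + 1)) \<le> C" by (auto simp: C_def add_nonneg_pos)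
  define \<eta> where "\<eta> = min (\<epsilon> / 4) ((\<epsilon> / 4)\<^sup>2 / (2 * C * Suc N))"
  have \<eta>: "\<eta> > 0" using assms C by (simp add: \<eta>_def)
  have main: "log_cap (deviation_set x \<epsilon> potential \<inter> {x - \<delta>\<^sup>2<..<x + \<delta>\<^sup>2}) \<le> ennreal ((\<delta>\<^sup>2) ^ Suc N)"
    if \<delta>: "0 < \<delta>" "\<delta> \<le> 1 / 2" "2 * \<delta> \<le> \<epsilon> / 2" "\<delta> \<le> exp (- 1)" and small: "- near x \<delta> x < \<eta>" for \<delta>
    unfolding log_cap_def
  proof (rule SUP_least, clarsimp)
    fix \<mu> assume \<mu>: "real_distribution \<mu>"
      and sub: "measure_support \<mu> \<subseteq> deviation_set x \<epsilon> potential"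
        "measure_support \<mu> \<subseteq> {x - \<delta>\<^sup>2<..<x + \<delta>\<^sup>2}"
    define I where "I = {x - \<delta><..<x + \<delta>}"
    define m where "m = measure \<kappa> I"
    define \<tau> where "\<tau> = density \<kappa> (indicator I)"
    define q where "q = 2 * Suc N * ln (1 / \<delta>)"
    have \<delta>2: "\<delta>\<^sup>2 \<le> \<delta>" using \<delta> mult_left_mono[of \<delta> 1 \<delta>] by (simp add: power2_eq_square)
    \<comment> \<open>The condition \<open>\<delta> \<le> exp (- 1)\<close> turns the bound on \<open>m ln (1/\<delta>)\<close> into one on \<open>m\<close> itself.\<close>
    have "ln \<delta> \<le> ln (exp (- 1))" using \<delta> by (subst ln_le_cancel_iff) auto
    then have ln1: "1 \<le> ln (1 / \<delta>)" using \<delta> by (simp add: ln_div)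
    have diam: "\<bar>s - t\<bar> \<le> 1" if "s \<in> I" "t \<in> I" for s t using that \<delta> by (auto simp: I_def)
    have AE\<mu>: "AE s in \<mu>. s \<in> deviation_set x \<epsilon> potential \<and> s \<in> {x - \<delta>\<^sup>2<..<x + \<delta>\<^sup>2}"
      using AE_in_measure_support[OF \<mu>] by eventually_elim (use sub in blast)
    then have \<mu>I: "AE s in \<mu>. s \<in> I" by eventually_elim (use \<delta>2 in \<open>auto simp: I_def\<close>)
    have m_ln: "m * ln (1 / \<delta>) < \<eta>"
      using near_mass_le[of \<delta> x] \<delta> small by (simp add: m_def I_def)
    have m: "0 \<le> m" "m < \<eta>"
      using m_ln mult_left_mono[OF ln1, of m] by (simp_all add: m_def)
    have "ennreal ((\<epsilon> / 2 / 2)\<^sup>2) \<le> (\<integral>\<^sup>+s. \<integral>\<^sup>+t. log_kernel s t \<partial>\<mu> \<partial>\<mu>) * (ennreal C * ennreal m)"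
    proof (rule energy_lower_bound[OF \<mu> _ _ diam \<mu>I])
      have em: "emeasure \<tau> (space \<tau>) = ennreal m"
        by (simp add: \<tau>_def m_def emeasure_density emeasure_eq_measure I_def)
      then show "emeasure \<tau> (space \<tau>) = ennreal m" .
      show "finite_measure \<tau>" using em by (intro finite_measureI) simp
      show "sets \<tau> = sets borel" by (simp add: \<tau>_def)
      show "AE t in \<tau>. t \<in> I" unfolding \<tau>_def I_def by (subst AE_density) (auto simp: indicator_def)
      show "(\<integral>\<^sup>+t. log_kernel s t \<partial>\<tau>) \<le> ennreal C" if "s \<in> I" for s
      proof -
        have "\<bar>s - x\<bar> < \<delta>" using that by (auto simp: I_def)
        then show ?thesis
          using nn_integral_log_kernel_near[of s x \<delta>] near_ge[of s x \<delta>] \<delta> C(2)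
          by (auto simp: \<tau>_def I_def intro!: ennreal_leI)
      qed
      show "AE s in \<mu>. ennreal (\<epsilon> / 2) \<le> (\<integral>\<^sup>+t. log_kernel s t \<partial>\<tau>)"
        using AE\<mu>
      proof eventually_elim
        case (elim s)
        then have s: "\<bar>s - x\<bar> < \<delta>\<^sup>2" by auto
        have "near x \<delta> s \<le> - (\<epsilon> / 2)"
          using deviation_near_le[of s x \<epsilon> \<delta>] elim s \<delta> small assms by (auto simp: \<eta>_def)
        then show ?case
          using nn_integral_log_kernel_near[of s x \<delta>] s \<delta> \<delta>2
          by (auto simp: \<tau>_def I_def intro!: ennreal_leI)
      qed
      show "m \<le> \<epsilon> / 2 / 2" using m by (simp add: \<eta>_def)
    qed (use m in auto)
    have q: "q \<ge> 0" using ln1 by (simp add: q_def)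
    have "ennreal q \<le> (\<integral>\<^sup>+s. \<integral>\<^sup>+t. log_kernel s t \<partial>\<mu> \<partial>\<mu>)"
    proof (rule ccontr)
      assume "\<not> ennreal q \<le> (\<integral>\<^sup>+s. \<integral>\<^sup>+t. log_kernel s t \<partial>\<mu> \<partial>\<mu>)"
      then have "(\<integral>\<^sup>+s. \<integral>\<^sup>+t. log_kernel s t \<partial>\<mu> \<partial>\<mu>) * (ennreal C * ennreal m) \<le> ennreal q * (ennreal C * ennreal m)"
        by (intro mult_right_mono) auto
      also have "\<dots> = ennreal (q * (C * m))" using q C m by (simp add: ennreal_mult)
      finally have "ennreal ((\<epsilon> / 2 / 2)\<^sup>2) \<le> ennreal (q * (C * m))"
        using \<open>ennreal ((\<epsilon> / 2 / 2)\<^sup>2) \<le> _\<close> by (rule order_trans[rotated])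
      then have "(\<epsilon> / 4)\<^sup>2 \<le> q * (C * m)" using q C m by (simp add: ennreal_le_iff)
      also have "\<dots> = (2 * C * Suc N) * (m * ln (1 / \<delta>))" by (simp add: q_def algebra_simps)
      also have "\<dots> < (2 * C * Suc N) * \<eta>" using m_ln C by (intro mult_strict_left_mono) auto
      also have "\<dots> \<le> (2 * C * Suc N) * ((\<epsilon> / 4)\<^sup>2 / (2 * C * Suc N))"
        using C by (intro mult_left_mono) (auto simp: \<eta>_def)
      also have "\<dots> = (\<epsilon> / 4)\<^sup>2" using C by simp
      finally show False by simp
    qed
    then have "exp_ext (log_energy \<mu>) \<le> ennreal (exp (- q))"
      using exp_log_energy_le[OF \<mu> diam \<mu>I q] by blast
    also have "exp (- q) = (\<delta>\<^sup>2) ^ Suc N"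
    proof -
      have "- q = of_nat (2 * Suc N) * ln \<delta>" using \<delta> by (simp add: q_def ln_div algebra_simps)
      then have "exp (- q) = exp (ln \<delta>) ^ (2 * Suc N)" by (simp only: exp_of_nat_mult)
      then show ?thesis using \<delta> by (simp only: exp_ln power_mult)
    qed
    finally show "exp_ext (log_energy \<mu>) \<le> ennreal (\<delta>\<^sup>2 * (\<delta>\<^sup>2) ^ N)" by simp
  qed
  have "\<forall>\<^sub>F \<delta> in at_right 0. near x \<delta> x > - \<eta>"
    using order_tendstoD(1)[OF near_tendsto_0, of "- \<eta>" x] \<eta> by simp
  moreover have "\<forall>\<^sub>F \<delta> in at_right (0::real). \<delta> < min (1 / 2) (min (\<epsilon> / 4) (exp (- 1)))"
    using assms by (intro order_tendstoD(2)[OF tendsto_ident_at]) auto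
  moreover have "\<forall>\<^sub>F \<delta> in at_right (0::real). \<delta> > 0" by (rule eventually_at_right_less)
  ultimately have "\<forall>\<^sub>F \<delta> in at_right 0.
      log_cap (deviation_set x \<epsilon> potential \<inter> {x - \<delta>\<^sup>2<..<x + \<delta>\<^sup>2}) \<le> ennreal ((\<delta>\<^sup>2) ^ Suc N)"
    by eventually_elim (rule main, auto)
  \<comment> \<open>Substitute \<open>\<delta> = sqrt h\<close>.\<close>
  moreover have "filterlim sqrt (at_right 0) (at_right 0)"
  proof -
    have "(sqrt \<longlongrightarrow> sqrt 0) (at_right 0)" by (intro tendsto_intros)
    moreover have "\<forall>\<^sub>F h in at_right (0::real). sqrt h > 0"
      using eventually_at_right_less[of "0::real"] by eventually_elim simp
    ultimately show ?thesis by (simp add: filterlim_at_withinI filterlim_at eventually_mono)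
  qed
  ultimately have "\<forall>\<^sub>F h in at_right 0.
      log_cap (deviation_set x \<epsilon> potential \<inter> {x - (sqrt h)\<^sup>2<..<x + (sqrt h)\<^sup>2}) \<le> ennreal (((sqrt h)\<^sup>2) ^ Suc N)"
    by (rule eventually_compose_filterlim)
  with eventually_at_right_less[of "0::real"] show ?thesis by eventually_elim simp
qed

end

section \<open>The Thouless formula\<close>

lemma exists_real_distribution_of_average:
  fixes \<xi> :: "nat \<Rightarrow> real"
  assumes "N \<ge> 1"
  shows "\<exists>\<zeta>. real_distribution \<zeta> \<and>
    (\<forall>f :: real \<Rightarrow> real. f \<in> borel_measurable borel \<longrightarrow> integral\<^sup>L \<zeta> f = (\<Sum>i<N. f (\<xi> i)) / N)"
proof -
  define U where "U = uniform_count_measure {..<N}"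
  interpret U: prob_space U
    unfolding U_def using assms by (intro prob_space_uniform_count_measure) (auto simp: lessThan_empty_iff)
  have meas: "\<xi> \<in> borel_measurable U"
    by (simp add: U_def measurable_def sets_uniform_count_measure space_uniform_count_measure)
  have "real_distribution (distr U borel \<xi>)"
    using U.real_distribution_distr meas by simp
  moreover have "integral\<^sup>L (distr U borel \<xi>) f = (\<Sum>i<N. f (\<xi> i)) / N"
    if "f \<in> borel_measurable borel" for f :: "real \<Rightarrow> real"
    using that meas by (simp add: integral_distr U_def integral_uniform_count_measure)
  ultimately show ?thesis by blast
qed

context bounded_jacobi
begin

text \<open>The normalized counting measure of the zeros of \<open>f_-(N+1)\<close>: its potential is
  \<open>(1/N) ln \<bar>a(1) \<dots> a(N) f_-(N+1)\<bar>\<close>.\<close>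

lemma f_minus_zero_distribution:
  assumes "N \<ge> 1"
  shows "\<exists>\<zeta>. real_distribution \<zeta> \<and> (AE t in \<zeta>. \<bar>t\<bar> \<le> 3 * M + 2) \<and>
    (\<forall>z. Im z > 0 \<longrightarrow> (\<integral>t. ln (cmod (z - of_real t)) \<partial>\<zeta>) = Re (w_minus a b N z) + ln (root N (\<Prod>i=1..N. a i)))"
proof -
  obtain \<xi> where \<xi>: "\<And>i. i < N \<Longrightarrow> \<bar>\<xi> i\<bar> \<le> 3 * M + 2"
    "\<And>z. of_real (\<Prod>i=1..N. a i) * f_minus a b (Suc N) z = (\<Prod>i<N. z - of_real (\<xi> i))"
    using f_minus_factorization[of N] by blast
  obtain \<zeta> where \<zeta>: "real_distribution \<zeta>"
    "\<And>f :: real \<Rightarrow> real. f \<in> borel_measurable borel \<Longrightarrow> integral\<^sup>L \<zeta> f = (\<Sum>i<N. f (\<xi> i)) / N"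
    using exists_real_distribution_of_average[OF assms, of \<xi>] by blast
  interpret Z: real_distribution \<zeta> by fact
  have "measure \<zeta> {t. \<bar>t\<bar> \<le> 3 * M + 2} = integral\<^sup>L \<zeta> (indicator {t. \<bar>t\<bar> \<le> 3 * M + 2})" by simp
  also have "\<dots> = 1" using assms \<xi>(1) by (subst \<zeta>(2)) auto
  finally have "AE t in \<zeta>. t \<in> {t. \<bar>t\<bar> \<le> 3 * M + 2}" by (rule Z.AE_prob_1)
  then have "AE t in \<zeta>. \<bar>t\<bar> \<le> 3 * M + 2" by simp
  moreover have "(\<integral>t. ln (cmod (z - of_real t)) \<partial>\<zeta>) = Re (w_minus a b N z) + ln (root N (\<Prod>i=1..N. a i))"
    if z: "Im z > 0" for z
  proof -
    have P: "(\<Prod>i=1..N. a i) > 0" using a_pos by (intro prod_pos) auto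
    have nz: "cmod (z - of_real t) > 0" for t using z by (auto simp: complex_eq_iff)
    have "(\<Sum>i<N. ln (cmod (z - of_real (\<xi> i)))) = ln (\<Prod>i<N. cmod (z - of_real (\<xi> i)))"
      using nz by (intro ln_prod[symmetric]) auto
    also have "\<dots> = ln ((\<Prod>i=1..N. a i) * cmod (f_minus a b (Suc N) z))"
      using arg_cong[OF \<xi>(2)[of z], of cmod] P by (simp add: prod_norm[symmetric] norm_mult abs_prod a_pos less_imp_le)
    also have "\<dots> = ln (\<Prod>i=1..N. a i) + ln (cmod (f_minus a b (Suc N) z))"
      using P f_minus_nonzero[of z N] z by (intro ln_mult_pos) auto
    finally have "(\<integral>t. ln (cmod (z - of_real t)) \<partial>\<zeta>)
        = (ln (\<Prod>i=1..N. a i) + ln (cmod (f_minus a b (Suc N) z))) / N"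
      by (subst \<zeta>(2)) auto
    then show ?thesis using assms P by (simp add: Re_w_minus[OF z] ln_root add_divide_distrib)
  qed
  ultimately show ?thesis using \<zeta>(1) by blast
qed

text \<open>Helly's theorem gives a weak limit along a subsequence. The integrand \<open>ln \<bar>z - t\<bar>\<close> is unbounded, so
  \<open>t\<close> is first clamped to the interval that contains all zeros; the limit measure is pushed
  forward under the same clamping.\<close>

lemma limit_is_log_potential:
  assumes Ns: "filterlim Ns at_top sequentially"
    and wp: "\<And>z. Im z > 0 \<Longrightarrow> (\<lambda>j. w_plus a b (Ns j) z) \<longlonglongrightarrow> wp z"
    and A: "A > 0" "(\<lambda>j. root (Ns j) (\<Prod>i=1..Ns j. a i)) \<longlonglongrightarrow> A"
  shows "\<exists>\<kappa>. real_distribution \<kappa> \<and> (AE t in \<kappa>. \<bar>t\<bar> \<le> 3 * M + 2) \<and>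
    (\<forall>z. Im z > 0 \<longrightarrow> (\<integral>t. ln (cmod (z - of_real t)) \<partial>\<kappa>) = ln A - Re (wp z))"
proof -
  define R where "R = 3 * M + 2"
  have R: "R > 0" using M_pos by (simp add: R_def)
  \<comment> \<open>Tightness concerns every index, so some measure has to be chosen for \<open>N = 0\<close> as well.\<close>
  have "\<exists>\<zeta>. real_distribution \<zeta> \<and> (AE t in \<zeta>. \<bar>t\<bar> \<le> R) \<and> (N \<ge> 1 \<longrightarrow>
      (\<forall>z. Im z > 0 \<longrightarrow> (\<integral>t. ln (cmod (z - of_real t)) \<partial>\<zeta>) = Re (w_minus a b N z) + ln (root N (\<Prod>i=1..N. a i))))" for N
  proof (cases "N \<ge> 1")
    case True
    then show ?thesis using f_minus_zero_distribution[OF True] unfolding R_def by blast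
  next
    case False
    then show ?thesis using f_minus_zero_distribution[of 1] unfolding R_def by auto
  qed
  then obtain \<zeta> where \<zeta>: "\<And>N. real_distribution (\<zeta> N)" "\<And>N. AE t in \<zeta> N. \<bar>t\<bar> \<le> R"
    "\<And>N z. N \<ge> 1 \<Longrightarrow> Im z > 0 \<Longrightarrow>
      (\<integral>t. ln (cmod (z - of_real t)) \<partial>\<zeta> N) = Re (w_minus a b N z) + ln (root N (\<Prod>i=1..N. a i))"
    by metis
  have "tight (\<lambda>j. \<zeta> (Ns j))"
    unfolding tight_def
  proof (intro conjI allI impI)
    fix \<epsilon> :: real assume \<epsilon>: "\<epsilon> > 0"
    have "measure (\<zeta> N) {-R-1<..R} = 1" for N
    proof -
      interpret Z: real_distribution "\<zeta> N" by fact
      have "AE t in \<zeta> N. t \<in> {-R-1<..R}" using \<zeta>(2)[of N] by eventually_elim auto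
      then show ?thesis by (simp add: Z.prob_eq_1)
    qed
    then show "\<exists>u v. u < v \<and> (\<forall>n. measure (\<zeta> (Ns n)) {u<..v} > 1 - \<epsilon>)"
      using \<epsilon> R by (intro exI[of _ "-R-1"] exI[of _ R]) auto
  qed (rule \<zeta>)
  from tight_imp_convergent_subsubsequence[OF this strict_mono_id] obtain r \<kappa>\<^sub>0
    where r: "strict_mono r" and \<kappa>\<^sub>0: "real_distribution \<kappa>\<^sub>0" "weak_conv_m ((\<lambda>j. \<zeta> (Ns j)) \<circ> id \<circ> r) \<kappa>\<^sub>0"
    by blast
  interpret K0: real_distribution \<kappa>\<^sub>0 by fact
  define c where "c t = max (- R) (min R t)" for t :: real
  have c_cont: "isCont c t" for t unfolding c_def by (intro continuous_intros)
  have c_meas [measurable]: "c \<in> borel_measurable borel" unfolding c_def by measurable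
  have c_bound: "\<bar>c t\<bar> \<le> R" for t using R by (auto simp: c_def)
  define \<kappa> where "\<kappa> = distr \<kappa>\<^sub>0 borel c"
  have \<kappa>: "real_distribution \<kappa>" unfolding \<kappa>_def by (rule K0.real_distribution_distr) simp
  have Nr: "filterlim (\<lambda>j. Ns (r j)) at_top sequentially"
    by (rule filterlim_compose[OF Ns filterlim_subseq[OF r]])
  have "(\<integral>t. ln (cmod (z - of_real t)) \<partial>\<kappa>) = ln A - Re (wp z)" if z: "Im z > 0" for z
  proof (rule LIMSEQ_unique)
    let ?f = "\<lambda>t. ln (cmod (z - of_real (c t)))"
    have ge: "Im z \<le> cmod (z - of_real t)" for t
      using abs_Im_le_cmod[of "z - of_real t"] by simp
    have nz: "cmod (z - of_real t) > 0" for t using ge[of t] z by linarith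
    have "(\<lambda>j. integral\<^sup>L (((\<lambda>j. \<zeta> (Ns j)) \<circ> id \<circ> r) j) ?f) \<longlonglongrightarrow> integral\<^sup>L \<kappa>\<^sub>0 ?f"
    proof (rule weak_conv_imp_integral_bdd_continuous_conv[OF _ \<kappa>\<^sub>0])
      show "real_distribution (((\<lambda>j. \<zeta> (Ns j)) \<circ> id \<circ> r) n)" for n by (simp add: \<zeta>)
      show "isCont ?f t" for t using nz by (intro continuous_intros c_cont) auto
      show "norm (?f t) \<le> \<bar>ln (Im z)\<bar> + \<bar>ln (cmod z + R)\<bar>" for t
      proof -
        have "cmod (z - of_real (c t)) \<le> cmod z + R"
          using norm_triangle_ineq4[of z "of_real (c t)"] c_bound[of t] by simp
        then have "ln (cmod (z - of_real (c t))) \<le> ln (cmod z + R)" "ln (Im z) \<le> ln (cmod (z - of_real (c t)))"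
          using nz[of "c t"] ge[of "c t"] z R by (subst ln_le_cancel_iff; linarith?)+
        then show ?thesis by simp
      qed
    qed
    moreover have "integral\<^sup>L \<kappa>\<^sub>0 ?f = (\<integral>t. ln (cmod (z - of_real t)) \<partial>\<kappa>)"
      unfolding \<kappa>_def by (rule integral_distr[symmetric]) auto
    moreover have "integral\<^sup>L (\<zeta> N) ?f = (\<integral>t. ln (cmod (z - of_real t)) \<partial>\<zeta> N)" for N
    proof -
      interpret Z: real_distribution "\<zeta> N" by fact
      show ?thesis
        by (rule integral_cong_AE, simp, simp, use \<zeta>(2)[of N] in eventually_elim) (auto simp: c_def)
    qed
    ultimately show "(\<lambda>j. \<integral>t. ln (cmod (z - of_real t)) \<partial>\<zeta> (Ns (r j))) \<longlonglongrightarrow> (\<integral>t. ln (cmod (z - of_real t)) \<partial>\<kappa>)"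
      by simp
    have "(\<lambda>j. (Re (w_plus a b (Ns (r j)) z) + Re (w_minus a b (Ns (r j)) z)) - Re (w_plus a b (Ns (r j)) z)
        + ln (root (Ns (r j)) (\<Prod>i=1..Ns (r j). a i))) \<longlonglongrightarrow> 0 - Re (wp z) + ln A"
    proof (intro tendsto_add tendsto_diff tendsto_Re tendsto_ln)
      show "(\<lambda>j. Re (w_plus a b (Ns (r j)) z) + Re (w_minus a b (Ns (r j)) z)) \<longlonglongrightarrow> 0"
        by (rule filterlim_compose[OF Re_w_sum_tendsto_0[OF z] Nr])
      show "(\<lambda>j. w_plus a b (Ns (r j)) z) \<longlonglongrightarrow> wp z"
        using LIMSEQ_subseq_LIMSEQ[OF wp[OF z] r] by (simp add: o_def)
      show "(\<lambda>j. root (Ns (r j)) (\<Prod>i=1..Ns (r j). a i)) \<longlonglongrightarrow> A"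
        using LIMSEQ_subseq_LIMSEQ[OF A(2) r] by (simp add: o_def)
    qed (use A in simp)
    moreover have "\<forall>\<^sub>F j in sequentially. Ns (r j) \<ge> 1"
      using Nr by (simp add: filterlim_at_top)
    then have "\<forall>\<^sub>F j in sequentially.
        (Re (w_plus a b (Ns (r j)) z) + Re (w_minus a b (Ns (r j)) z)) - Re (w_plus a b (Ns (r j)) z)
        + ln (root (Ns (r j)) (\<Prod>i=1..Ns (r j). a i)) = (\<integral>t. ln (cmod (z - of_real t)) \<partial>\<zeta> (Ns (r j)))"
      by eventually_elim (use \<zeta>(3) z in simp)
    ultimately show "(\<lambda>j. \<integral>t. ln (cmod (z - of_real t)) \<partial>\<zeta> (Ns (r j))) \<longlonglongrightarrow> ln A - Re (wp z)"
      by (simp add: tendsto_cong)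
  qed
  moreover have "AE t in \<kappa>. \<bar>t\<bar> \<le> R" unfolding \<kappa>_def by (subst AE_distr_iff) (auto simp: c_bound)
  ultimately show ?thesis using \<kappa> unfolding R_def by blast
qed

lemma limit_Re_nonpos:
  assumes "filterlim Ns at_top sequentially" "Im z > 0" "(\<lambda>j. w_plus a b (Ns j) z) \<longlonglongrightarrow> w"
  shows "Re w \<le> 0"
  using Re_w_plus_limsup[OF assms(2,1)] tendsto_Re[OF assms(3)] by blast

end

section \<open>Boundary values of the potential\<close>

text \<open>For \<open>t \<noteq> x\<close>, the values \<open>ln \<bar>x + i y - t\<bar>\<close> decrease to \<open>ln \<bar>x - t\<bar>\<close> as \<open>y\<close> tends to 0. Fatou's lemma,
  applied to \<open>ln D - ln \<bar>x + i y - t\<bar> \<ge> 0\<close> and combined with the lower bound on the potential, shows that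
  the limit function is integrable, with value infinity at \<open>t = x\<close>; hence there are no atoms.
  Dominated convergence then gives the boundary values.\<close>

lemma boundary_potential:
  assumes "real_distribution \<kappa>" and support: "AE t in \<kappa>. \<bar>t\<bar> \<le> R"
    and ge: "\<And>z. Im z > 0 \<Longrightarrow> l \<le> (\<integral>t. ln (cmod (z - of_real t)) \<partial>\<kappa>)"
  shows "log_potential \<kappa> R l"
    and "((\<lambda>y. \<integral>t. ln (cmod (Complex x y - of_real t)) \<partial>\<kappa>) \<longlongrightarrow> (\<integral>t. ln \<bar>x - t\<bar> \<partial>\<kappa>)) (at_right 0)"
proof -
  interpret K: real_distribution \<kappa> by fact
  let ?L = "\<lambda>x y t. ln (cmod (Complex x y - of_real t))"
  define D where "D x = \<bar>R\<bar> + \<bar>x\<bar> + 1" for x :: real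
  have cm: "cmod (Complex x y - of_real t) = sqrt ((x - t)\<^sup>2 + y\<^sup>2)" for x y t by (simp add: cmod_def)
  have upper: "?L x y t \<le> ln (D x)" if "0 < y" "y \<le> 1" "\<bar>t\<bar> \<le> R" for x y t
  proof -
    have "cmod (Complex x y - of_real t) \<le> \<bar>x - t\<bar> + \<bar>y\<bar>" by (metis cmod_le complex.sel minus_complex.sel Im_complex_of_real Re_complex_of_real diff_zero)
    also have "\<dots> \<le> D x" using that by (auto simp: D_def)
    finally show ?thesis using that by (subst ln_le_cancel_iff) (auto simp: D_def complex_eq_iff)
  qed
  have lower: "ln \<bar>x - t\<bar> \<le> ?L x y t" if "t \<noteq> x" for x y t
  proof -
    have "\<bar>x - t\<bar> \<le> cmod (Complex x y - of_real t)"
      using abs_Re_le_cmod[of "Complex x y - of_real t"] by simp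
    then show ?thesis using that by (subst ln_le_cancel_iff) auto
  qed
  have meas [measurable]: "?L x y \<in> borel_measurable borel" for x y unfolding cm by measurable
  have int: "integrable \<kappa> (?L x y)" if y: "0 < y" "y \<le> 1" for x y
  proof (rule K.integrable_const_bound[where B = "\<bar>ln y\<bar> + \<bar>ln (D x)\<bar>"])
    have ln_y: "ln y \<le> ?L x y t" for t
    proof -
      have "y \<le> cmod (Complex x y - of_real t)"
        using abs_Im_le_cmod[of "Complex x y - of_real t"] by simp
      then show ?thesis using y by (subst ln_le_cancel_iff) auto
    qed
    show "AE t in \<kappa>. norm (?L x y t) \<le> \<bar>ln y\<bar> + \<bar>ln (D x)\<bar>"
      using support
    proof eventually_elim
      case (elim t)
      then show ?case using upper[OF y, of t x] ln_y[of t] by simp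
    qed
  qed simp
  have lim: "((\<lambda>y. ?L x y t) \<longlongrightarrow> ln \<bar>x - t\<bar>) (at_right 0)" if "t \<noteq> x" for x t
  proof -
    have "((\<lambda>y. ln (sqrt ((x - t)\<^sup>2 + y\<^sup>2))) \<longlongrightarrow> ln (sqrt ((x - t)\<^sup>2 + 0\<^sup>2))) (at_right 0)"
      using that by (intro tendsto_intros) auto
    then show ?thesis by (simp add: cm)
  qed
  define G where "G x t = (if t = x then \<infinity> else ennreal (ln (D x) - ln \<bar>x - t\<bar>))" for x t :: real
  have G_meas [measurable]: "G x \<in> borel_measurable borel" for x unfolding G_def by measurable
  have G: "(\<integral>\<^sup>+t. G x t \<partial>\<kappa>) \<le> ennreal (ln (D x) - l)" for x
  proof -
    define e where "e n = 1 / real (Suc n)" for n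
    have e: "0 < e n" "e n \<le> 1" for n by (auto simp: e_def)
    have e_lim: "e \<longlonglongrightarrow> 0" unfolding e_def by (rule LIMSEQ_inverse_real_of_nat[unfolded inverse_eq_divide])
    then have e': "filterlim e (at_right 0) sequentially"
      using e by (simp add: filterlim_at less_imp_neq[symmetric])
    have F: "(\<integral>\<^sup>+t. ennreal (ln (D x) - ?L x (e n) t) \<partial>\<kappa>) \<le> ennreal (ln (D x) - l)" for n
    proof -
      have "(\<integral>\<^sup>+t. ennreal (ln (D x) - ?L x (e n) t) \<partial>\<kappa>) = ennreal (\<integral>t. ln (D x) - ?L x (e n) t \<partial>\<kappa>)"
        by (rule nn_integral_eq_integral)
           (use int[OF e] in simp, use support in eventually_elim, use upper[OF e] in simp)
      also have "(\<integral>t. ln (D x) - ?L x (e n) t \<partial>\<kappa>) = ln (D x) - (\<integral>t. ?L x (e n) t \<partial>\<kappa>)"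
        using int[OF e] K.prob_space by simp
      also have "ennreal \<dots> \<le> ennreal (ln (D x) - l)"
        using ge[of "Complex x (e n)"] e by (intro ennreal_leI) simp
      finally show ?thesis .
    qed
    have "G x t = liminf (\<lambda>n. ennreal (ln (D x) - ?L x (e n) t))" for t
    proof (rule lim_imp_Liminf[symmetric], simp)
      show "(\<lambda>n. ennreal (ln (D x) - ?L x (e n) t)) \<longlonglongrightarrow> G x t"
      proof (cases "t = x")
        case False
        then show ?thesis unfolding G_def
          using filterlim_compose[OF lim[OF False] e'] by (auto intro!: tendsto_intros tendsto_ennrealI)
      next
        case True
        have "filterlim (\<lambda>n. ln (e n)) at_bot sequentially"
          by (rule filterlim_compose[OF ln_at_0 e'])
        then have "filterlim (\<lambda>n. ln (D x) + - ln (e n)) at_top sequentially"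
          by (intro filterlim_tendsto_add_at_top[OF tendsto_const]) (simp add: filterlim_uminus_at_top)
        then have "(\<lambda>n. ennreal (ln (D x) + - ln (e n))) \<longlonglongrightarrow> \<infinity>"
          by (simp add: ennreal_tendsto_top_eq_at_top)
        moreover have "?L x (e n) t = ln (e n)" for n using True e[of n] by (simp add: cm)
        ultimately show ?thesis using True by (simp add: G_def)
      qed
    qed
    then have "(\<integral>\<^sup>+t. G x t \<partial>\<kappa>) = (\<integral>\<^sup>+t. liminf (\<lambda>n. ennreal (ln (D x) - ?L x (e n) t)) \<partial>\<kappa>)" by simp
    also have "\<dots> \<le> liminf (\<lambda>n. \<integral>\<^sup>+t. ennreal (ln (D x) - ?L x (e n) t) \<partial>\<kappa>)"
      by (rule nn_integral_liminf) simp
    also have "\<dots> \<le> limsup (\<lambda>n. ennreal (ln (D x) - l))"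
      by (rule order_trans[OF Liminf_le_Limsup Limsup_mono]) (use F in auto)
    also have "\<dots> = ennreal (ln (D x) - l)" by (simp add: Limsup_const)
    finally show ?thesis .
  qed
  have no_atom: "AE t in \<kappa>. t \<noteq> x" for x
  proof -
    have "(\<integral>\<^sup>+t. G x t \<partial>\<kappa>) \<noteq> \<infinity>" using G[of x] by (auto simp: top_unique)
    then have "AE t in \<kappa>. G x t \<noteq> \<infinity>" by (intro nn_integral_PInf_AE) simp
    then show ?thesis by eventually_elim (auto simp: G_def)
  qed
  have int0: "integrable \<kappa> (\<lambda>t. ln \<bar>x - t\<bar>)" for x
  proof -
    have "integrable \<kappa> (\<lambda>t. ln (D x) - ln \<bar>x - t\<bar>)"
    proof (rule integrableI_nonneg)
      show "AE t in \<kappa>. 0 \<le> ln (D x) - ln \<bar>x - t\<bar>"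
        using support no_atom[of x]
      proof eventually_elim
        case (elim t)
        then have "ln \<bar>x - t\<bar> \<le> ln (D x)" by (subst ln_le_cancel_iff) (auto simp: D_def)
        then show ?case by simp
      qed
      have "(\<integral>\<^sup>+t. ennreal (ln (D x) - ln \<bar>x - t\<bar>) \<partial>\<kappa>) = (\<integral>\<^sup>+t. G x t \<partial>\<kappa>)"
        by (rule nn_integral_cong_AE, use no_atom[of x] in eventually_elim) (simp add: G_def)
      then show "(\<integral>\<^sup>+t. ennreal (ln (D x) - ln \<bar>x - t\<bar>) \<partial>\<kappa>) < \<infinity>"
        using G[of x] by (simp add: le_less_trans)
    qed simp
    then have "integrable \<kappa> (\<lambda>t. ln (D x) - (ln (D x) - ln \<bar>x - t\<bar>))"
      by (rule Bochner_Integration.integrable_diff[rotated]) simp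
    then show ?thesis by simp
  qed
  have conv: "((\<lambda>y. \<integral>t. ?L x y t \<partial>\<kappa>) \<longlongrightarrow> (\<integral>t. ln \<bar>x - t\<bar> \<partial>\<kappa>)) (at_right 0)" for x
  proof (rule tendsto_integral_at_right[where b = 1 and w = "\<lambda>t. \<bar>ln \<bar>x - t\<bar>\<bar> + \<bar>ln (D x)\<bar>"])
    show "integrable \<kappa> (\<lambda>t. \<bar>ln \<bar>x - t\<bar>\<bar> + \<bar>ln (D x)\<bar>)" using int0[of x] by simp
    show "AE t in \<kappa>. ((\<lambda>y. ?L x y t) \<longlongrightarrow> ln \<bar>x - t\<bar>) (at_right 0)"
      using no_atom[of x] by eventually_elim (rule lim)
    show "AE t in \<kappa>. \<bar>?L x y t\<bar> \<le> \<bar>ln \<bar>x - t\<bar>\<bar> + \<bar>ln (D x)\<bar>" if "0 < y" "y < 1" for y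
      using no_atom[of x] support
    proof eventually_elim
      case (elim t)
      then show ?case using lower[of t x y] upper[of y t x] that by linarith
    qed
  qed auto
  then show "((\<lambda>y. \<integral>t. ?L x y t \<partial>\<kappa>) \<longlongrightarrow> (\<integral>t. ln \<bar>x - t\<bar> \<partial>\<kappa>)) (at_right 0)" .
  show "log_potential \<kappa> R l"
  proof unfold_locales
    fix x
    show "l \<le> (\<integral>t. ln \<bar>x - t\<bar> \<partial>\<kappa>)"
    proof (rule tendsto_lowerbound[OF conv])
      show "\<forall>\<^sub>F y in at_right 0. l \<le> (\<integral>t. ?L x y t \<partial>\<kappa>)"
        using eventually_at_right_less[of "0::real"] by eventually_elim (rule ge, simp)
    qed simp
  qed (use support no_atom int0 in auto)
qed

section \<open>Capacity of the deviations of the Lyapunov exponent\<close>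

theorem theorem1p6:
  fixes a b :: "nat \<Rightarrow> real" and M :: real
    and E :: "real \<Rightarrow> (nat \<Rightarrow> complex) \<Rightarrow> (nat \<Rightarrow> complex)"
    and Nseq :: "nat \<Rightarrow> nat"
    and wp wm g :: "complex \<Rightarrow> complex"
    and \<nu> dk :: "real measure"
    and A :: real
    and \<gamma> :: "real \<Rightarrow> real"
    and x \<epsilon> :: real and N :: nat
  assumes "M > 0"
    and "\<And>n. n \<ge> 1 \<Longrightarrow> 1 / (M + 1) \<le> a n \<and> a n \<le> M + 1"
    and "\<And>n. n \<ge> 1 \<Longrightarrow> \<bar>b n\<bar> \<le> M"
    and "a 0 = 1"
    and "spectral_resolution (jacobi_op a b) E"
    and "filterlim Nseq at_top sequentially"
    and "herglotz wp" and "loc_uniform_lim (\<lambda>j. w_plus a b (Nseq j)) wp"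
    and "herglotz wm" and "loc_uniform_lim (\<lambda>j. w_minus a b (Nseq j)) wm"
    and "herglotz g" and "loc_uniform_lim (\<lambda>j. g_avg a b (Nseq j)) g"
    and "real_distribution \<nu>" and "weak_star_lim (\<lambda>j. nu_measure E (Nseq j)) \<nu>"
    and "real_distribution dk" and "weak_star_lim (\<lambda>j. dk_measure a b (Nseq j)) dk"
    and "A > 0"
    and "(\<lambda>j. root (Nseq j) (\<Prod>i=1..Nseq j. a i)) \<longlonglongrightarrow> A"
    and "\<gamma> = lyapunov wp"
    and "\<epsilon> > 0" and "N \<ge> 1"
  shows "(\<lambda>h. enn2real (log_cap (deviation_set x \<epsilon> \<gamma> \<inter> {x - h<..<x + h})))
           \<in> o[at_right 0](\<lambda>h. h ^ N)"
proof -
  interpret bounded_jacobi a b M by unfold_locales (use assms in auto)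
  have wp: "(\<lambda>j. w_plus a b (Nseq j) z) \<longlonglongrightarrow> wp z" if "Im z > 0" for z
  proof -
    have "compact {z}" "{z} \<subseteq> upper_half_plane" using that by (auto simp: upper_half_plane_def)
    then have "uniform_limit {z} (\<lambda>j. w_plus a b (Nseq j)) wp sequentially"
      using \<open>loc_uniform_lim (\<lambda>j. w_plus a b (Nseq j)) wp\<close> unfolding loc_uniform_lim_def by blast
    then show ?thesis by (rule tendsto_uniform_limitI) simp
  qed
  obtain \<kappa> where \<kappa>: "real_distribution \<kappa>" "AE t in \<kappa>. \<bar>t\<bar> \<le> 3 * M + 2"
    and pot: "\<And>z. Im z > 0 \<Longrightarrow> (\<integral>t. ln (cmod (z - of_real t)) \<partial>\<kappa>) = ln A - Re (wp z)"
    using limit_is_log_potential[OF \<open>filterlim Nseq at_top sequentially\<close> wp \<open>A > 0\<close>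
        \<open>(\<lambda>j. root (Nseq j) (\<Prod>i=1..Nseq j. a i)) \<longlonglongrightarrow> A\<close>] by blast
  have ge: "ln A \<le> (\<integral>t. ln (cmod (z - of_real t)) \<partial>\<kappa>)" if "Im z > 0" for z
    using limit_Re_nonpos[OF \<open>filterlim Nseq at_top sequentially\<close> that wp[OF that]] pot[OF that] by simp
  note boundary = boundary_potential[OF \<kappa> ge]
  interpret log_potential \<kappa> "3 * M + 2" "ln A" by (rule boundary)
  have \<gamma>: "\<gamma> y = potential y - ln A" for y
  proof -
    have "((\<lambda>v. (\<integral>t. ln (cmod (Complex y v - of_real t)) \<partial>\<kappa>) - ln A) \<longlongrightarrow> potential y - ln A) (at_right 0)"
      unfolding potential_def by (intro tendsto_diff boundary(2) tendsto_const)
    moreover have "\<forall>\<^sub>F v in at_right 0.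
        (\<integral>t. ln (cmod (Complex y v - of_real t)) \<partial>\<kappa>) - ln A = - Re (wp (Complex y v))"
      using eventually_at_right_less[of "0::real"] by eventually_elim (subst pot, auto)
    ultimately have "((\<lambda>v. - Re (wp (Complex y v))) \<longlongrightarrow> potential y - ln A) (at_right 0)"
      by (simp add: tendsto_cong)
    then show ?thesis
      unfolding \<open>\<gamma> = lyapunov wp\<close> lyapunov_def by (intro tendsto_Lim) auto
  qed
  have dev: "deviation_set x \<epsilon> \<gamma> = deviation_set x \<epsilon> potential"
    by (simp add: deviation_set_def \<gamma>)
  show ?thesis
    unfolding dev
  proof (rule landau_o.smallI)
    fix c :: real assume c: "c > 0"
    have "\<forall>\<^sub>F h in at_right (0::real). h < c"
      using c by (intro order_tendstoD(2)[OF tendsto_ident_at]) auto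
    with deviation_capacity_small[OF \<open>\<epsilon> > 0\<close>, of x N] eventually_at_right_less[of "0::real"]
    show "\<forall>\<^sub>F h in at_right 0. norm (enn2real (log_cap (deviation_set x \<epsilon> potential \<inter> {x - h<..<x + h}))) \<le> c * norm (h ^ N)"
    proof eventually_elim
      case (elim h)
      then have "enn2real (log_cap (deviation_set x \<epsilon> potential \<inter> {x - h<..<x + h})) \<le> h ^ Suc N"
        by (intro enn2real_leI) auto
      also have "\<dots> \<le> c * h ^ N" using elim by (simp add: mult_right_mono)
      finally show ?case using elim by simp
    qed
  qed
qed

end
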